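(* Let $\alpha_L,\alpha_R,\mu_L,\mu_R,\gamma_{RL},\gamma_{LR},\delta_L,\delta_R,\rho>0$ and consider on $\mathcal T=\{(L,R,A)\in\mathbb{R}^3: L,R,A\ge0,\ L+R+A\le1\}$ the autonomous system \[ \begin{aligned} \dot L&=\alpha_L L C+\gamma_{RL} R C+\delta_L A L-\mu_L L,\\ \dot R&=\alpha_R R C+\gamma_{LR} L C+\delta_R A R-\mu_R R,\\ \dot A&=-\delta_L A L-\delta_R A R-\rho A, \end{aligned}\qquad C=1-L-R-A. \] Let $K=\begin{pmatrix}\alpha_L&\gamma_{RL}\\ \gamma_{LR}&\alpha_R\end{pmatrix}$, $M=\mathrm{diag}(\mu_L,\mu_R)$ and $\mathcal R_{\mathrm{rad}}=\lambda_{\mathrm{PF}}(M^{-1}K)$ (the Perron root). Then: (i) If $\mathcal R_{\mathrm{rad}}\le1$, the equilibrium $E_0=(0,0,0)$ is globally asymptotically stable on $\mathcal T$. (ii) If $\mathcal R_{\mathrm{rad}}>1$, let $E_1=(L^*,R^*,0)$ be the unique equilibrium of the system with $L^*>0$ and $R^*>0$. The axis $\Gamma=\{(L,R,A)\in\mathcal T: L=R=0\}$ is forward invariant and every trajectory starting on $\Gamma$ converges to $E_0$; every trajectory starting in $\mathcal T\setminus\Gamma$ converges to $E_1$ as $t\to\infty$.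
   Context: $L,R,C,A$ are left-radical, right-radical, centrist and (excess crisis-induced) disengaged shares of an electorate, with $L+R+C+A=1$. This is the post-shock system (external shock intensity zero). *)

theory Defs
  imports "HOL-Analysis.Analysis"
begin

type_synonym state = "real \<times> real \<times> real"  (* (L, R, A) *)

definition simplexT :: "state set" where
  "simplexT = {(L, R, A). L \<ge> 0 \<and> R \<ge> 0 \<and> A \<ge> 0 \<and> L + R + A \<le> 1}"

definition axisGamma :: "state set" where
  "axisGamma = {(L, R, A). (L, R, A) \<in> simplexT \<and> L = 0 \<and> R = 0}"

definition field ::
  "real \<Rightarrow> real \<Rightarrow> real \<Rightarrow> real \<Rightarrow> real \<Rightarrow> real \<Rightarrow> real \<Rightarrow> real \<Rightarrow> real
   \<Rightarrow> state \<Rightarrow> state" where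
  "field aL aR mL mR gRL gLR dL dR rho = (\<lambda>(L, R, A).
     let C = 1 - L - R - A in
     (aL * L * C + gRL * R * C + dL * A * L - mL * L,
      aR * R * C + gLR * L * C + dR * A * R - mR * R,
      - dL * A * L - dR * A * R - rho * A))"

definition trajectory :: "(state \<Rightarrow> state) \<Rightarrow> (real \<Rightarrow> state) \<Rightarrow> bool" where
  "trajectory F x \<longleftrightarrow> x 0 \<in> simplexT \<and>
     (\<forall>t\<ge>0. (x has_vector_derivative F (x t)) (at t within {0..}))"

definition equilibrium :: "(state \<Rightarrow> state) \<Rightarrow> state \<Rightarrow> bool" where
  "equilibrium F e \<longleftrightarrow> F e = 0"

definition GAS_on_T :: "(state \<Rightarrow> state) \<Rightarrow> state \<Rightarrow> bool" where
  "GAS_on_T F e \<longleftrightarrow> equilibrium F e \<and>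
     (\<forall>\<epsilon>>0. \<exists>\<delta>>0. \<forall>x. trajectory F x \<and> dist (x 0) e < \<delta> \<longrightarrow>
         (\<forall>t\<ge>0. dist (x t) e < \<epsilon>)) \<and>
     (\<forall>x. trajectory F x \<longrightarrow> (x \<longlongrightarrow> e) at_top)"

text \<open>Perron root of a real 2x2 matrix: its largest real eigenvalue
  (for a positive matrix this is the Perron--Frobenius eigenvalue).\<close>
definition perron_root :: "real^2^2 \<Rightarrow> real" where
  "perron_root B = Max {l. det (mat l - B) = 0}"

definition Kmat :: "real \<Rightarrow> real \<Rightarrow> real \<Rightarrow> real \<Rightarrow> real^2^2" where
  "Kmat aL aR gRL gLR = (\<chi> i j. if i = 1 then (if j = 1 then aL else gRL)
                                   else (if j = 1 then gLR else aR))"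

definition Mmat :: "real \<Rightarrow> real \<Rightarrow> real^2^2" where
  "Mmat mL mR = (\<chi> i j. if i = j then (if i = 1 then mL else mR) else 0)"

definition R_rad :: "real \<Rightarrow> real \<Rightarrow> real \<Rightarrow> real \<Rightarrow> real \<Rightarrow> real \<Rightarrow> real" where
  "R_rad aL aR mL mR gRL gLR =
     perron_root (matrix_inv (Mmat mL mR) ** Kmat aL aR gRL gLR)"

end

theory Submission
  imports Defs
begin

text \<open>
  The simplex is forward invariant because the sum \<open>N\<close> of the squared negative parts of
  \<open>L\<close>, \<open>R\<close>, \<open>A\<close>, \<open>C\<close> satisfies \<open>N' \<le> K N\<close> on compact time intervals; then
  \<open>A\<close> decays like \<open>exp (- rho t)\<close> and acts as a vanishing perturbation of the planar system.
  For a Perron root \<open>\<lambda> \<le> 1\<close>, a positive left eigenvector \<open>w\<close> of \<open>K\<close> relative to \<open>\<lambda> M\<close> makes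
  \<open>W = w \<bullet> (L, R)\<close> satisfy \<open>W' \<le> - c W\<^sup>2 + O(A W)\<close>.
  For \<open>\<lambda> > 1\<close> use the coordinates \<open>xi = ln (L / R)\<close> and \<open>S = L + R\<close>. By the symmetry exchanging
  \<open>L\<close> and \<open>R\<close> one may assume \<open>mL \<le> mR\<close>. If \<open>mL = mR\<close>, \<open>xi\<close> converges on its own and \<open>S\<close> follows.
  If \<open>mL < mR\<close>, trajectories enter a strip on which the nullcline of \<open>xi\<close> is the graph of
  \<open>D / q(xi)\<close>, and there a Lyapunov function
  \<open>Phi(xi) + S - S\<^sup>* - S\<^sup>* ln (S / S\<^sup>*)\<close> exists.
\<close>

section \<open>Differential inequalities and Lyapunov functions\<close>

text \<open>At interior points the derivative within the half-line is the two-sided one, so the mean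
  value theorem applies. The form with \<open>at t within {0..}\<close> matches what
  \<open>trajectory\<close> supplies, including the one-sided derivative at time 0.\<close>

lemma deriv_nonpos_imp_le:
  fixes f f' :: "real \<Rightarrow> real"
  assumes "a \<le> b" "0 \<le> a"
    and der: "\<And>t. t \<ge> 0 \<Longrightarrow> (f has_real_derivative f' t) (at t within {0..})"
    and nonpos: "\<And>t. a < t \<Longrightarrow> t < b \<Longrightarrow> f' t \<le> 0"
  shows "f b \<le> f a"
proof (rule DERIV_nonpos_imp_decreasing_open[OF \<open>a \<le> b\<close>])
  fix t assume t: "a < t" "t < b"
  with assms have "t \<in> interior {0..}" by simp
  then show "\<exists>y. DERIV f t :> y \<and> y \<le> 0"
    using der[of t] nonpos[OF t] t assms(2) at_within_interior[of t "{0..}"] by auto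
next
  have "continuous_on {0..} f"
    using der by (meson DERIV_continuous continuous_on_eq_continuous_within atLeast_iff)
  then show "continuous_on {a..b} f"
    by (rule continuous_on_subset) (use assms in auto)
qed

lemma deriv_pos_imp_less:
  fixes f f' :: "real \<Rightarrow> real"
  assumes "a < b" "0 \<le> a"
    and der: "\<And>t. t \<ge> 0 \<Longrightarrow> (f has_real_derivative f' t) (at t within {0..})"
    and pos: "\<And>t. a < t \<Longrightarrow> t < b \<Longrightarrow> f' t > 0"
  shows "f a < f b"
proof (rule DERIV_pos_imp_increasing_open[OF \<open>a < b\<close>])
  fix t assume t: "a < t" "t < b"
  with assms have "t \<in> interior {0..}" by simp
  then show "\<exists>y. DERIV f t :> y \<and> y > 0"
    using der[of t] pos[OF t] t assms(2) at_within_interior[of t "{0..}"] by auto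
next
  have "continuous_on {0..} f"
    using der by (meson DERIV_continuous continuous_on_eq_continuous_within atLeast_iff)
  then show "continuous_on {a..b} f"
    by (rule continuous_on_subset) (use assms in auto)
qed

text \<open>Squaring removes the kink of the negative part at 0, so sums of squared negative parts
  can be differentiated along an orbit without tracking signs.\<close>

lemma DERIV_min_0_power2:
  fixes x :: real
  shows "((\<lambda>x. (min 0 x)\<^sup>2) has_real_derivative 2 * min 0 x) (at x within S)"
proof -
  have "((\<lambda>x. (min 0 x)\<^sup>2) has_real_derivative 2 * min 0 x) (at x)"
  proof (cases x "0::real" rule: linorder_cases)
    case less
    show ?thesis
      by (rule has_field_derivative_transform_within_open[of "\<lambda>x. x\<^sup>2" _ _ "{..<0}"])
        (use less in \<open>auto intro!: derivative_eq_intros\<close>)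
  next
    case greater
    show ?thesis
      by (rule has_field_derivative_transform_within_open[of "\<lambda>x. 0" _ _ "{0<..}"])
        (use greater in \<open>auto intro!: derivative_eq_intros\<close>)
  next
    case equal
    have "((\<lambda>h. (min 0 h)\<^sup>2 / h) \<longlongrightarrow> 0) (at (0::real))"
    proof (rule tendsto_rabs_zero_cancel, rule tendsto_sandwich[OF _ _ tendsto_const])
      have "(min 0 h)\<^sup>2 / \<bar>h\<bar> \<le> \<bar>h\<bar>" for h :: real
        by (cases "h = 0") (auto simp: min_def divide_simps power2_eq_square)
      then show "\<forall>\<^sub>F h in at (0::real). \<bar>(min 0 h)\<^sup>2 / h\<bar> \<le> \<bar>h\<bar>" by simp
      show "((\<lambda>h. \<bar>h\<bar>) \<longlongrightarrow> 0) (at (0::real))"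
        by (rule tendsto_eq_intros refl | simp)+
    qed auto
    then show ?thesis
      using equal by (simp add: DERIV_def)
  qed
  then show ?thesis
    by (rule has_field_derivative_at_within)
qed

text \<open>A drift of at most \<open>- d\<close> above the level \<open>e\<close> brings
  \<open>f\<close> below \<open>e\<close> in finite time. Afterwards \<open>f\<close> cannot exceed
  \<open>e\<close>: from its last visit to that level it would have to climb while its derivative is
  nonpositive.\<close>

lemma eventually_le_if_decreasing_above:
  fixes f f' :: "real \<Rightarrow> real"
  assumes der: "\<forall>\<^sub>F t in at_top. (f has_real_derivative f' t) (at t)"
    and dec: "\<forall>\<^sub>F t in at_top. f t \<ge> e \<longrightarrow> f' t \<le> - d"
    and d: "d > 0"
  shows "\<forall>\<^sub>F t in at_top. f t \<le> e"
proof -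
  obtain T where T: "\<And>t. t \<ge> T \<Longrightarrow> (f has_real_derivative f' t) (at t)"
    "\<And>t. t \<ge> T \<Longrightarrow> f t \<ge> e \<Longrightarrow> f' t \<le> - d"
    using eventually_conj[OF der dec] unfolding eventually_at_top_linorder by blast
  have cont: "continuous_on {a..b} f" if "T \<le> a" for a b
    using T(1) that by (meson DERIV_isCont atLeastAtMost_iff continuous_at_imp_continuous_on order_trans)
  have "\<exists>s\<ge>T. f s < e"
  proof (rule ccontr)
    assume "\<not> ?thesis"
    then have ge: "f s \<ge> e" if "s \<ge> T" for s using that by force
    \<comment> \<open>Descending at speed \<open>d\<close> from \<open>f T\<close> leads to at most
      \<open>e - d\<close> at time \<open>b\<close>.\<close>
    define b where "b = T + (f T - e) / d + 1"
    have Tb: "T \<le> b" using ge[of T] d by (simp add: b_def)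
    have "f b + d * b \<le> f T + d * T"
    proof (rule DERIV_nonpos_imp_nonincreasing[OF Tb, of "\<lambda>t. f t + d * t"])
      fix t assume t: "T \<le> t" "t \<le> b"
      have "((\<lambda>t. f t + d * t) has_real_derivative f' t + d) (at t)"
        using T(1)[OF t(1)] by (auto intro!: derivative_eq_intros)
      then show "\<exists>y. ((\<lambda>t. f t + d * t) has_real_derivative y) (at t) \<and> y \<le> 0"
        using T(2)[OF t(1) ge[OF t(1)]] by force
    qed
    moreover have "d * b = d * T + (f T - e) + d" using d by (simp add: b_def field_simps)
    ultimately have "f b < e" using d by linarith
    with ge[OF Tb] show False by simp
  qed
  then obtain s where s: "s \<ge> T" "f s < e" by blast
  have "f t \<le> e" if t: "t \<ge> s" for t
  proof (rule ccontr)
    assume "\<not> f t \<le> e"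
    then have ft: "f t > e" by simp
    \<comment> \<open>\<open>x\<close> is the last time before \<open>t\<close> at which
      \<open>f\<close> equals \<open>e\<close>, obtained as the maximum of the compact set
      \<open>Z\<close> of such times.\<close>
    have "\<exists>x\<ge>s. x \<le> t \<and> f x = e \<and> (\<forall>y. x < y \<and> y \<le> t \<longrightarrow> f y \<ge> e)"
    proof -
      define Z where "Z = {s..t} \<inter> f -` {e}"
      have "closed Z"
        unfolding Z_def by (rule continuous_closed_preimage[OF cont[OF s(1)]]) auto
      moreover have "bounded Z"
        by (rule bounded_subset[OF bounded_closed_interval]) (auto simp: Z_def)
      ultimately have "compact Z"
        by (simp add: compact_eq_bounded_closed)
      moreover have "Z \<noteq> {}"
        using IVT'[of f s e t] s ft t cont[OF s(1)] unfolding Z_def by auto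
      ultimately obtain x where x: "x \<in> Z" "\<And>y. y \<in> Z \<Longrightarrow> y \<le> x"
        using compact_attains_sup[of Z] by blast
      have "f y \<ge> e" if y: "x < y" "y \<le> t" for y
      proof (rule ccontr)
        assume "\<not> f y \<ge> e"
        moreover have "continuous_on {y..t} f"
          using cont[of y t] s x(1) y unfolding Z_def by auto
        ultimately obtain z where "y \<le> z" "z \<le> t" "f z = e"
          using IVT'[of f y e t] ft y by auto
        then have "z \<in> Z" using x(1) y unfolding Z_def by auto
        with x(2) \<open>y \<le> z\<close> y show False by force
      qed
      then show ?thesis using x(1) unfolding Z_def by auto
    qed
    then obtain x where x: "x \<ge> s" "x \<le> t" "f x = e" "\<And>y. x \<le> y \<Longrightarrow> y \<le> t \<Longrightarrow> f y \<ge> e"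
      by (metis order.order_iff_strict)
    have "f t \<le> f x"
    proof (rule DERIV_nonpos_imp_nonincreasing[OF x(2)])
      fix y assume y: "x \<le> y" "y \<le> t"
      then have "y \<ge> T" using x s by simp
      from T(1)[OF this] T(2)[OF this x(4)[OF y]] d
      show "\<exists>z. (f has_real_derivative z) (at y) \<and> z \<le> 0" by (intro exI[of _ "f' y"]) auto
    qed
    with x ft show False by simp
  qed
  then show ?thesis unfolding eventually_at_top_linorder by blast
qed

text \<open>Off a ball around \<open>z\<close> the function \<open>U\<close> is at least some
  \<open>m > 0\<close>. Where \<open>V \<ge> m / 2\<close> the orbit is away from \<open>z\<close>,
  so \<open>W\<close> is bounded below and, once \<open>err\<close> is small, \<open>V\<close>
  strictly decreases. Hence finally \<open>U \<le> V \<le> m / 2\<close>, which traps the orbit in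
  the ball. Continuity on \<open>K\<close> is asked of \<open>U\<close> and not of \<open>V\<close>,
  because the logarithmic \<open>V\<close> used later degenerates on the edge
  \<open>S = 0\<close>.\<close>

lemma Lyapunov_tendsto:
  fixes X :: "real \<Rightarrow> 'a::metric_space" and v' err :: "real \<Rightarrow> real" and V U W :: "'a \<Rightarrow> real"
  assumes K: "compact K" "z \<in> K" "\<forall>\<^sub>F t in at_top. X t \<in> K"
    and contU: "continuous_on K U" and contW: "continuous_on K W"
    and posU: "\<And>x. x \<in> K \<Longrightarrow> x \<noteq> z \<Longrightarrow> U x > 0"
    and posW: "\<And>x. x \<in> K \<Longrightarrow> x \<noteq> z \<Longrightarrow> W x > 0"
    and contV: "isCont V z" and Vz: "V z = 0"
    and UV: "\<forall>\<^sub>F t in at_top. U (X t) \<le> V (X t)"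
    and der: "\<forall>\<^sub>F t in at_top. ((\<lambda>t. V (X t)) has_real_derivative v' t) (at t)"
    and dec: "\<forall>\<^sub>F t in at_top. v' t \<le> - W (X t) + err t"
    and err: "(err \<longlongrightarrow> 0) at_top"
  shows "(X \<longlongrightarrow> z) at_top"
proof (rule tendstoI)
  have away: "\<exists>m>0. \<forall>x\<in>K - ball z \<eta>. m \<le> Y x"
    if "\<eta> > 0" "continuous_on K Y" "\<And>x. x \<in> K \<Longrightarrow> x \<noteq> z \<Longrightarrow> Y x > 0" for \<eta> and Y :: "'a \<Rightarrow> real"
  proof (cases "K - ball z \<eta> = {}")
    case True
    then show ?thesis by (intro exI[of _ 1]) auto
  next
    case False
    have "compact (K - ball z \<eta>)" "continuous_on (K - ball z \<eta>) Y"
      using K(1) that(2) by (auto intro: compact_diff continuous_on_subset)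
    then obtain x where x: "x \<in> K - ball z \<eta>" "\<And>y. y \<in> K - ball z \<eta> \<Longrightarrow> Y x \<le> Y y"
      using continuous_attains_inf[OF _ False, of Y] by blast
    then show ?thesis using that(1) that(3)[of x] by (cases "x = z") (auto intro!: exI[of _ "Y x"])
  qed
  fix \<epsilon> :: real assume "\<epsilon> > 0"
  from away[OF this contU posU] obtain m where m: "m > 0" "\<And>x. x \<in> K - ball z \<epsilon> \<Longrightarrow> m \<le> U x" by blast
  obtain \<eta> where \<eta>: "\<eta> > 0" "\<And>x. dist x z < \<eta> \<Longrightarrow> V x < m / 2"
  proof -
    from contV[unfolded continuous_at_eps_delta, rule_format, of "m / 2"] m(1)
    obtain d where "d > 0" "\<forall>x. dist x z < d \<longrightarrow> dist (V x) (V z) < m / 2" by auto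
    then show ?thesis by (intro that[of d]) (auto simp: dist_real_def Vz)
  qed
  from away[OF \<eta>(1) contW posW] obtain w where w: "w > 0" "\<And>x. x \<in> K - ball z \<eta> \<Longrightarrow> w \<le> W x" by blast
  have "\<forall>\<^sub>F t in at_top. err t < w / 2"
    using order_tendstoD(2)[OF err, of "w / 2"] w(1) by simp
  then have "\<forall>\<^sub>F t in at_top. m / 2 \<le> V (X t) \<longrightarrow> v' t \<le> - (w / 2)"
    using dec K(3)
  proof eventually_elim
    case (elim t)
    show ?case
    proof
      assume "m / 2 \<le> V (X t)"
      with \<eta>(2)[of "X t"] have "X t \<in> K - ball z \<eta>" using elim by (force simp: dist_commute)
      from w(2)[OF this] elim show "v' t \<le> - (w / 2)" by simp
    qed
  qed
  from eventually_le_if_decreasing_above[OF der this] w(1)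
  have "\<forall>\<^sub>F t in at_top. V (X t) \<le> m / 2" by simp
  then show "\<forall>\<^sub>F t in at_top. dist (X t) z < \<epsilon>"
    using UV K(3)
  proof eventually_elim
    case (elim t)
    show ?case
    proof (rule ccontr)
      assume "\<not> ?thesis"
      then have "m \<le> U (X t)" using elim m(2)[of "X t"] by (auto simp: dist_commute)
      then show False using elim m(1) by linarith
    qed
  qed
qed

section \<open>Invariance of the simplex and positivity\<close>

locale radicalization =
  fixes aL aR mL mR gRL gLR dL dR rho :: real
  assumes pos: "aL > 0" "aR > 0" "mL > 0" "mR > 0" "gRL > 0" "gLR > 0"
    "dL > 0" "dR > 0" "rho > 0"

text \<open>\<open>C\<close> is a parameter tied down by \<open>C_eq\<close>, so that exchanging the
  two radical groups yields another instance of the same locale.\<close>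

locale radicalization_orbit = radicalization +
  fixes L R A C :: "real \<Rightarrow> real"
  assumes C_eq: "C t = 1 - L t - R t - A t"
    and init: "L 0 \<ge> 0" "R 0 \<ge> 0" "A 0 \<ge> 0" "C 0 \<ge> 0"
    and DL: "t \<ge> 0 \<Longrightarrow> (L has_real_derivative
      aL * L t * C t + gRL * R t * C t + dL * A t * L t - mL * L t) (at t within {0..})"
    and DR: "t \<ge> 0 \<Longrightarrow> (R has_real_derivative
      aR * R t * C t + gLR * L t * C t + dR * A t * R t - mR * R t) (at t within {0..})"
    and DA: "t \<ge> 0 \<Longrightarrow> (A has_real_derivative
      - dL * A t * L t - dR * A t * R t - rho * A t) (at t within {0..})"
begin

text \<open>The system is symmetric under exchanging \<open>L\<close> and \<open>R\<close> together
  with their coefficients, so every one-sided result below serves both groups.\<close>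

lemma swap: "radicalization_orbit aR aL mR mL gLR gRL dR dL rho R L A C"
proof unfold_locales
  fix t
  show "C t = 1 - R t - L t - A t" by (simp add: C_eq)
  assume t: "t \<ge> 0"
  show "(R has_real_derivative aR * R t * C t + gLR * L t * C t + dR * A t * R t - mR * R t) (at t within {0..})"
    by (rule DR[OF t])
  show "(L has_real_derivative aL * L t * C t + gRL * R t * C t + dL * A t * L t - mL * L t) (at t within {0..})"
    by (rule DL[OF t])
  show "(A has_real_derivative - dR * A t * R t - dL * A t * L t - rho * A t) (at t within {0..})"
    by (rule DERIV_cong[OF DA[OF t]]) simp
qed (use pos init in auto)

text \<open>The \<open>dL\<close> and \<open>dR\<close> terms cancel, since radicalization of the
  disengaged does not touch the centrist share. What remains is a loss proportional to
  \<open>C\<close> and inflows from the other shares.\<close>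

lemma DC: "t \<ge> 0 \<Longrightarrow> (C has_real_derivative
    - C t * ((aL + gLR) * L t + (aR + gRL) * R t) + mL * L t + mR * R t + rho * A t) (at t within {0..})"
  unfolding C_eq[abs_def]
  by (auto intro!: derivative_eq_intros DL DR DA simp: C_eq algebra_simps)

lemma continuous_components:
  "continuous_on {0..} L" "continuous_on {0..} R" "continuous_on {0..} A" "continuous_on {0..} C"
  by (auto simp: continuous_on_eq_continuous_within intro!: DERIV_continuous DL DR DA DC)

text \<open>The derivative of each component is a multiple of that component plus products of the
  others with nonnegative coefficients. This yields a Gronwall inequality for the sum
  \<open>N\<close> of squared negative parts, and \<open>N\<close> vanishes at time 0. The argument
  applies to any given trajectory directly, without appeal to uniqueness of solutions.\<close>

lemma nonneg:
  assumes "t \<ge> 0"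
  shows "L t \<ge> 0" "R t \<ge> 0" "A t \<ge> 0" "C t \<ge> 0"
proof -
  have bdd: "\<exists>B. \<forall>s\<in>{0..t}. \<bar>f s\<bar> \<le> B" if "continuous_on {0..} f" for f :: "real \<Rightarrow> real"
  proof -
    have "compact (f ` {0..t})"
      by (rule compact_continuous_image[OF continuous_on_subset[OF that]]) auto
    then show ?thesis
      unfolding compact_eq_bounded_closed bounded_iff by auto
  qed
  obtain B1 where B1: "\<And>s. s \<in> {0..t} \<Longrightarrow> \<bar>L s\<bar> \<le> B1" using bdd[OF continuous_components(1)] by blast
  obtain B2 where B2: "\<And>s. s \<in> {0..t} \<Longrightarrow> \<bar>R s\<bar> \<le> B2" using bdd[OF continuous_components(2)] by blast
  obtain B3 where B3: "\<And>s. s \<in> {0..t} \<Longrightarrow> \<bar>A s\<bar> \<le> B3" using bdd[OF continuous_components(3)] by blast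
  obtain B4 where B4: "\<And>s. s \<in> {0..t} \<Longrightarrow> \<bar>C s\<bar> \<le> B4" using bdd[OF continuous_components(4)] by blast
  define B where "B = \<bar>B1\<bar> + \<bar>B2\<bar> + \<bar>B3\<bar> + \<bar>B4\<bar>"
  have B: "\<bar>L s\<bar> \<le> B" "\<bar>R s\<bar> \<le> B" "\<bar>A s\<bar> \<le> B" "\<bar>C s\<bar> \<le> B" if "0 \<le> s" "s \<le> t" for s
    using B1[of s] B2[of s] B3[of s] B4[of s] that unfolding B_def by auto
  define N where "N s = (min 0 (L s))\<^sup>2 + (min 0 (R s))\<^sup>2 + (min 0 (A s))\<^sup>2 + (min 0 (C s))\<^sup>2" for s
  define N' where "N' s = 2 * min 0 (L s) * (aL * L s * C s + gRL * R s * C s + dL * A s * L s - mL * L s)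
    + 2 * min 0 (R s) * (aR * R s * C s + gLR * L s * C s + dR * A s * R s - mR * R s)
    + 2 * min 0 (A s) * (- dL * A s * L s - dR * A s * R s - rho * A s)
    + 2 * min 0 (C s) * (- C s * ((aL + gLR) * L s + (aR + gRL) * R s) + mL * L s + mR * R s + rho * A s)" for s
  have DN: "(N has_real_derivative N' s) (at s within {0..})" if "s \<ge> 0" for s
    unfolding N_def[abs_def] N'_def
    by (intro DERIV_add DERIV_chain2[OF DERIV_min_0_power2] DL DR DA DC that)
  have sq: "n * min 0 x \<le> n\<^sup>2 + (min 0 x)\<^sup>2" for n x :: real
  proof -
    have "0 \<le> (n - min 0 x)\<^sup>2 + n\<^sup>2 + (min 0 x)\<^sup>2" by simp
    then show ?thesis unfolding power2_diff by linarith
  qed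
  \<comment> \<open>The terms of \<open>N'\<close> are of three kinds: a component times a bounded
    rate (\<open>self\<close>), a linear inflow (\<open>lin\<close>) and a bilinear inflow
    (\<open>bil\<close>).\<close>
  have self: "2 * min 0 x * (x * c) \<le> 2 * K * (min 0 x)\<^sup>2" if "c \<le> K" for x c K :: real
    using mult_right_mono[OF that, of "2 * (min 0 x)\<^sup>2"] by (auto simp: min_def power2_eq_square algebra_simps)
  have lin: "2 * min 0 x * (c * y) \<le> 2 * c * ((min 0 x)\<^sup>2 + (min 0 y)\<^sup>2)" if "c \<ge> 0" for x y c :: real
  proof -
    have "min 0 x * y \<le> min 0 x * min 0 y"
      by (rule mult_left_mono_neg) auto
    also have "\<dots> \<le> (min 0 x)\<^sup>2 + (min 0 y)\<^sup>2" by (rule sq)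
    finally have "2 * c * (min 0 x * y) \<le> 2 * c * ((min 0 x)\<^sup>2 + (min 0 y)\<^sup>2)"
      by (rule mult_left_mono) (use that in auto)
    then show ?thesis by (simp add: algebra_simps)
  qed
  have bil: "2 * min 0 x * (c * y * z) \<le> 2 * c * B * (2 * (min 0 x)\<^sup>2 + (min 0 y)\<^sup>2 + (min 0 z)\<^sup>2)"
    if c: "c \<ge> 0" and "\<bar>y\<bar> \<le> B" "\<bar>z\<bar> \<le> B" for x y z c :: real
  proof -
    have B0: "B \<ge> 0" using that by linarith
    \<comment> \<open>A product of two negative factors is harmless. With just one negative factor,
      the other is bounded by \<open>B\<close>.\<close>
    have "B * (min 0 y + min 0 z) \<le> y * z"
    proof -
      consider "y \<ge> 0" "z \<ge> 0" | "y \<ge> 0" "z \<le> 0" | "y \<le> 0" "z \<ge> 0" | "y \<le> 0" "z \<le> 0" by linarith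
      then show ?thesis
      proof cases
        case 1 then show ?thesis by simp
      next
        case 2 then show ?thesis using mult_right_mono_neg[of y B z] that by simp
      next
        case 3 then show ?thesis using mult_left_mono_neg[of z B y] that by (simp add: mult.commute)
      next
        case 4
        have "B * (y + z) \<le> 0" using B0 4 by (intro mult_nonneg_nonpos) auto
        with 4 show ?thesis using mult_nonpos_nonpos[of y z] by simp
      qed
    qed
    then have "min 0 x * (y * z) \<le> min 0 x * (B * (min 0 y + min 0 z))"
      by (rule mult_left_mono_neg) auto
    also have "\<dots> = B * (min 0 x * min 0 y + min 0 x * min 0 z)" by (simp add: algebra_simps)
    also have "\<dots> \<le> B * (2 * (min 0 x)\<^sup>2 + (min 0 y)\<^sup>2 + (min 0 z)\<^sup>2)"
      using sq[of "min 0 x" y] sq[of "min 0 x" z] B0 by (intro mult_left_mono) auto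
    finally have "2 * c * (min 0 x * (y * z)) \<le> 2 * c * (B * (2 * (min 0 x)\<^sup>2 + (min 0 y)\<^sup>2 + (min 0 z)\<^sup>2))"
      by (rule mult_left_mono) (use c in auto)
    then show ?thesis by (simp add: algebra_simps)
  qed
  \<comment> \<open>One constant that dominates every coefficient occurring in the nine terms of
    \<open>N'\<close>; each term is then at most \<open>4 * P * N s\<close>.\<close>
  define P where "P = aL * B + dL * B + mL + aR * B + dR * B + mR + rho
    + (aL + gLR) * B + (aR + gRL) * B + gRL * B + gLR * B"
  have "\<exists>K. \<forall>s\<in>{0..t}. N' s \<le> K * N s"
  proof (intro exI ballI)
    fix s assume "s \<in> {0..t}"
    then have s: "0 \<le> s" "s \<le> t" by auto
    note b = B[OF s]
    have B0: "B \<ge> 0" using b by linarith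
    have ub: "c * x \<le> c * B" "- c * x \<le> c * B" if "\<bar>x\<bar> \<le> B" "c > 0" for c x :: real
      using that mult_left_mono[of x B c] mult_left_mono[of "-x" B c] by auto
    have nn: "aL * B \<ge> 0" "dL * B \<ge> 0" "aR * B \<ge> 0" "dR * B \<ge> 0" "gRL * B \<ge> 0" "gLR * B \<ge> 0"
      using pos B0 by simp_all
    have P_exp: "P = aL * B + dL * B + mL + aR * B + dR * B + mR + rho
      + (aL * B + gLR * B) + (aR * B + gRL * B) + gRL * B + gLR * B"
      by (simp add: P_def algebra_simps)
    have "aL * C s \<le> aL * B" "dL * A s \<le> dL * B" "aR * C s \<le> aR * B" "dR * A s \<le> dR * B"
      "- dL * L s \<le> dL * B" "- dR * R s \<le> dR * B"
      "- (aL + gLR) * L s \<le> (aL + gLR) * B" "- (aR + gRL) * R s \<le> (aR + gRL) * B"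
      by (intro ub b; use pos in simp)+
    then have P1: "aL * C s + dL * A s - mL \<le> P" "aR * C s + dR * A s - mR \<le> P"
      "- dL * L s - dR * R s - rho \<le> P" "- (aL + gLR) * L s - (aR + gRL) * R s \<le> P"
      using nn pos distrib_right[of aL gLR B] distrib_right[of aR gRL B] unfolding P_exp by linarith+
    have P2: "gRL * B \<le> P" "gLR * B \<le> P" "mL \<le> P" "mR \<le> P" "rho \<le> P" "P \<ge> 0"
      using nn pos unfolding P_exp by linarith+
    let ?l = "(min 0 (L s))\<^sup>2" and ?r = "(min 0 (R s))\<^sup>2" and ?a = "(min 0 (A s))\<^sup>2" and ?c = "(min 0 (C s))\<^sup>2"
    have N0: "?l \<ge> 0" "?r \<ge> 0" "?a \<ge> 0" "?c \<ge> 0" "N s = ?l + ?r + ?a + ?c" by (auto simp: N_def)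
    have le: "2 * q * x \<le> 2 * P * (2 * N s)" if "q \<le> P" "0 \<le> x" "x \<le> 2 * N s" for q x
      using mult_mono[of "2 * q" "2 * P" x "2 * N s"] that P2(6) by linarith
    have bB: "2 * c * B * x \<le> 2 * P * (2 * N s)" if "c * B \<le> P" "0 \<le> x" "x \<le> 2 * N s" for c x
      using le[OF that] by (simp add: mult.assoc)
    have e: "N' s = 2 * min 0 (L s) * (L s * (aL * C s + dL * A s - mL))
      + 2 * min 0 (L s) * (gRL * R s * C s)
      + 2 * min 0 (R s) * (R s * (aR * C s + dR * A s - mR))
      + 2 * min 0 (R s) * (gLR * L s * C s)
      + 2 * min 0 (A s) * (A s * (- dL * L s - dR * R s - rho))
      + 2 * min 0 (C s) * (C s * (- (aL + gLR) * L s - (aR + gRL) * R s))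
      + 2 * min 0 (C s) * (mL * L s) + 2 * min 0 (C s) * (mR * R s) + 2 * min 0 (C s) * (rho * A s)"
      unfolding N'_def by (simp add: algebra_simps)
    have "2 * min 0 (L s) * (L s * (aL * C s + dL * A s - mL)) \<le> 2 * P * (2 * N s)"
      by (rule order_trans[OF self[OF P1(1)] le]) (use N0 in linarith)+
    moreover have "2 * min 0 (R s) * (R s * (aR * C s + dR * A s - mR)) \<le> 2 * P * (2 * N s)"
      by (rule order_trans[OF self[OF P1(2)] le]) (use N0 in linarith)+
    moreover have "2 * min 0 (A s) * (A s * (- dL * L s - dR * R s - rho)) \<le> 2 * P * (2 * N s)"
      by (rule order_trans[OF self[OF P1(3)] le]) (use N0 in linarith)+
    moreover have "2 * min 0 (C s) * (C s * (- (aL + gLR) * L s - (aR + gRL) * R s)) \<le> 2 * P * (2 * N s)"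
      by (rule order_trans[OF self[OF P1(4)] le]) (use N0 in linarith)+
    moreover have "2 * min 0 (L s) * (gRL * R s * C s) \<le> 2 * P * (2 * N s)"
      by (rule order_trans[OF bil bB[OF P2(1)]]) (use N0 b pos in linarith)+
    moreover have "2 * min 0 (R s) * (gLR * L s * C s) \<le> 2 * P * (2 * N s)"
      by (rule order_trans[OF bil bB[OF P2(2)]]) (use N0 b pos in linarith)+
    moreover have "2 * min 0 (C s) * (mL * L s) \<le> 2 * P * (2 * N s)"
      by (rule order_trans[OF lin le[OF P2(3)]]) (use N0 b pos in linarith)+
    moreover have "2 * min 0 (C s) * (mR * R s) \<le> 2 * P * (2 * N s)"
      by (rule order_trans[OF lin le[OF P2(4)]]) (use N0 b pos in linarith)+
    moreover have "2 * min 0 (C s) * (rho * A s) \<le> 2 * P * (2 * N s)"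
      by (rule order_trans[OF lin le[OF P2(5)]]) (use N0 b pos in linarith)+
    ultimately have "N' s \<le> 9 * (2 * P * (2 * N s))"
      unfolding e by linarith
    then show "N' s \<le> 36 * P * N s" by (simp add: algebra_simps)
  qed
  then obtain K where K: "\<And>s. 0 \<le> s \<Longrightarrow> s \<le> t \<Longrightarrow> N' s \<le> K * N s"
    unfolding Ball_def atLeastAtMost_iff by blast
  \<comment> \<open>Gronwall's inequality by means of an integrating factor.\<close>
  have "N t * exp (- K * t) \<le> N 0 * exp (- K * 0)"
  proof (rule deriv_nonpos_imp_le[OF assms order_refl])
    show "((\<lambda>t. N t * exp (- K * t)) has_real_derivative (N' s - K * N s) * exp (- K * s))
      (at s within {0..})" if "s \<ge> 0" for s
      by (rule derivative_eq_intros DN that refl | simp)+ (simp add: algebra_simps)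
    show "(N' s - K * N s) * exp (- K * s) \<le> 0" if "0 < s" "s < t" for s
      using K[of s] that by (intro mult_nonpos_nonneg) auto
  qed
  also have "N 0 = 0" using init by (simp add: N_def)
  finally have "N t \<le> 0" by (simp add: mult_le_0_iff)
  moreover have "(min 0 (L t))\<^sup>2 \<ge> 0" "(min 0 (R t))\<^sup>2 \<ge> 0" "(min 0 (A t))\<^sup>2 \<ge> 0" "(min 0 (C t))\<^sup>2 \<ge> 0"
    by simp_all
  ultimately have "(min 0 (L t))\<^sup>2 = 0" "(min 0 (R t))\<^sup>2 = 0" "(min 0 (A t))\<^sup>2 = 0" "(min 0 (C t))\<^sup>2 = 0"
    unfolding N_def by linarith+
  then show "L t \<ge> 0" "R t \<ge> 0" "A t \<ge> 0" "C t \<ge> 0"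
    by (auto simp: min_def split: if_splits)
qed

lemma le_one:
  assumes "t \<ge> 0" shows "L t \<le> 1" "R t \<le> 1" "A t \<le> 1" "C t \<le> 1" "L t + R t \<le> 1"
  using nonneg[OF assms] C_eq[of t] by linarith+

section \<open>Exponential decay of the disengaged share and invariance of the axis\<close>

lemma A_antimono:
  assumes "t \<ge> 0" shows "A t * exp (rho * t) \<le> A 0"
proof -
  have "A t * exp (rho * t) \<le> A 0 * exp (rho * 0)"
  proof (rule deriv_nonpos_imp_le[OF assms order_refl])
    show "((\<lambda>t. A t * exp (rho * t)) has_real_derivative
        - (dL * A s * L s + dR * A s * R s) * exp (rho * s)) (at s within {0..})" if "s \<ge> 0" for s
      by (rule derivative_eq_intros DA that refl | simp)+ (simp add: algebra_simps)
    show "- (dL * A s * L s + dR * A s * R s) * exp (rho * s) \<le> 0" if "0 < s" for s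
    proof (intro mult_nonpos_nonneg)
      have "dL * A s * L s \<ge> 0" "dR * A s * R s \<ge> 0" using nonneg[of s] that pos by auto
      then show "- (dL * A s * L s + dR * A s * R s) \<le> 0" by linarith
    qed auto
  qed
  then show ?thesis by simp
qed

lemma A_le:
  assumes "t \<ge> 0" shows "A t \<le> A 0 * exp (- rho * t)" "A t \<le> A 0"
proof -
  show *: "A t \<le> A 0 * exp (- rho * t)"
    using A_antimono[OF assms] by (simp add: exp_minus field_simps)
  have "A 0 * exp (- rho * t) \<le> A 0"
    using pos assms init by (intro mult_left_le) auto
  with * show "A t \<le> A 0" by simp
qed

lemma A_tendsto: "(A \<longlongrightarrow> 0) at_top"
proof (rule tendsto_sandwich[OF _ _ tendsto_const])
  show "\<forall>\<^sub>F t in at_top. 0 \<le> A t" "\<forall>\<^sub>F t in at_top. A t \<le> A 0 * exp (- rho * t)"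
    by (rule eventually_mono[OF eventually_ge_at_top[of 0]], erule nonneg A_le)+
  have "((\<lambda>t. A 0 * exp (- (rho * t))) \<longlongrightarrow> A 0 * 0) at_top"
    by (intro tendsto_mult tendsto_const filterlim_compose[OF exp_at_bot]
        filterlim_compose[OF filterlim_uminus_at_bot_at_top] filterlim_tendsto_pos_mult_at_top[OF tendsto_const])
      (use pos in \<open>auto simp: filterlim_ident\<close>)
  then show "((\<lambda>t. A 0 * exp (- rho * t)) \<longlongrightarrow> 0) at_top" by simp
qed

lemma eventually_A_mult_less:
  fixes K e :: real
  assumes "e > 0" shows "\<forall>\<^sub>F t in at_top. A t * K < e"
  using tendsto_mult[OF A_tendsto tendsto_const[of K]] assms order_tendstoD(2) by fastforce

text \<open>Gronwall's inequality for \<open>L + R\<close> takes the place of a uniqueness theorem: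
  both shares are nonnegative and their sum grows at most exponentially.\<close>

lemma radicals_zero:
  assumes "L 0 = 0" "R 0 = 0" "t \<ge> 0" shows "L t = 0" "R t = 0"
proof -
  \<comment> \<open>The sum of all gain rates; since \<open>C\<close> and \<open>A\<close> are at
    most 1, \<open>K * (L + R)\<close> dominates all gains.\<close>
  define K where "K = aL + gLR + aR + gRL + dL + dR"
  have "(L t + R t) * exp (- K * t) \<le> (L 0 + R 0) * exp (- K * 0)"
  proof (rule deriv_nonpos_imp_le[OF assms(3) order_refl])
    show "((\<lambda>t. (L t + R t) * exp (- K * t)) has_real_derivative
        ((aL + gLR) * L s * C s + (aR + gRL) * R s * C s + dL * A s * L s + dR * A s * R s - mL * L s - mR * R s
          - K * (L s + R s)) * exp (- K * s)) (at s within {0..})" if "s \<ge> 0" for s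
      by (rule derivative_eq_intros DL DR that refl | simp)+ (simp add: algebra_simps)
    show "((aL + gLR) * L s * C s + (aR + gRL) * R s * C s + dL * A s * L s + dR * A s * R s - mL * L s - mR * R s
          - K * (L s + R s)) * exp (- K * s) \<le> 0" if "0 < s" for s
    proof (intro mult_nonpos_nonneg)
      have s: "s \<ge> 0" using that by simp
      note n = nonneg[OF s] le_one[OF s]
      have "(aL + gLR) * L s * C s \<le> (aL + gLR) * L s" "(aR + gRL) * R s * C s \<le> (aR + gRL) * R s"
        "dL * L s * A s \<le> dL * L s" "dR * R s * A s \<le> dR * R s"
        using n pos by (auto intro!: mult_left_le)
      moreover have "K * (L s + R s) = (aL + gLR) * L s + (aR + gRL) * R s + dL * L s + dR * R s
        + ((aL + gLR + dL) * R s + (aR + gRL + dR) * L s)" by (simp add: K_def algebra_simps)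
      moreover have "(aL + gLR + dL) * R s + (aR + gRL + dR) * L s \<ge> 0" "mL * L s \<ge> 0" "mR * R s \<ge> 0"
        using n pos by (auto intro!: add_nonneg_nonneg mult_nonneg_nonneg)
      ultimately show "(aL + gLR) * L s * C s + (aR + gRL) * R s * C s + dL * A s * L s + dR * A s * R s
          - mL * L s - mR * R s - K * (L s + R s) \<le> 0" by (simp add: mult.commute mult.left_commute)
    qed auto
  qed
  then have "L t + R t \<le> 0" using assms by (simp add: mult_le_0_iff)
  with nonneg[OF assms(3)] show "L t = 0" "R t = 0" by auto
qed

section \<open>Strict positivity of both radical shares off the axis\<close>

lemma L_mono:
  assumes "0 \<le> s" "s \<le> t" shows "L s * exp (mL * s) \<le> L t * exp (mL * t)"
proof -
  have "- (L t * exp (mL * t)) \<le> - (L s * exp (mL * s))"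
  proof (rule deriv_nonpos_imp_le[OF assms(2,1)])
    show "((\<lambda>t. - (L t * exp (mL * t))) has_real_derivative
        - (aL * L u * C u + gRL * R u * C u + dL * A u * L u) * exp (mL * u)) (at u within {0..})" if "u \<ge> 0" for u
      by (rule derivative_eq_intros DL that refl | simp)+ (simp add: algebra_simps)
    show "- (aL * L u * C u + gRL * R u * C u + dL * A u * L u) * exp (mL * u) \<le> 0" if "s < u" for u
    proof (intro mult_nonpos_nonneg)
      have "aL * L u * C u \<ge> 0" "gRL * R u * C u \<ge> 0" "dL * A u * L u \<ge> 0"
        using nonneg[of u] that pos assms by auto
      then show "- (aL * L u * C u + gRL * R u * C u + dL * A u * L u) \<le> 0" by linarith
    qed auto
  qed
  then show ?thesis by simp
qed

text \<open>Positivity spreads in the order \<open>R\<close>, \<open>C\<close>, \<open>L\<close>: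
  \<open>R\<close> loses at most at rate \<open>mR\<close>, its removal term then feeds
  \<open>C\<close>, and the cross-recruitment \<open>gRL * R * C\<close> feeds \<open>L\<close>.
  Strict positivity holds only for \<open>t > 0\<close>, because \<open>C 0\<close> and
  \<open>L 0\<close> may vanish.\<close>

lemma pos_if_R_pos:
  assumes R0: "R 0 > 0" and t: "t > 0"
  shows "L t > 0" "R t > 0" "C t > 0"
proof -
  have Rpos: "R s > 0" if "s \<ge> 0" for s
  proof -
    interpret sw: radicalization_orbit aR aL mR mL gLR gRL dR dL rho R L A C by (rule swap)
    have "0 < R 0 * exp (mR * 0)" using R0 by simp
    also have "\<dots> \<le> R s * exp (mR * s)" by (rule sw.L_mono) (use that in auto)
    finally show ?thesis by (simp add: zero_less_mult_iff)
  qed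
  \<comment> \<open>An upper bound for the rate at which \<open>C\<close> is lost, so that
    \<open>C\<close> times \<open>exp (k * t)\<close> increases strictly.\<close>
  define k where "k = aL + gLR + aR + gRL"
  have Cpos: "C s > 0" if "s > 0" for s
  proof -
    have "C 0 * exp (k * 0) < C s * exp (k * s)"
    proof (rule deriv_pos_imp_less[OF that order_refl])
      show "((\<lambda>t. C t * exp (k * t)) has_real_derivative
          (C u * (k - ((aL + gLR) * L u + (aR + gRL) * R u)) + mL * L u + mR * R u + rho * A u) * exp (k * u))
          (at u within {0..})" if "u \<ge> 0" for u
        by (rule derivative_eq_intros DC that refl | simp)+ (simp add: algebra_simps)
      show "(C u * (k - ((aL + gLR) * L u + (aR + gRL) * R u)) + mL * L u + mR * R u + rho * A u) * exp (k * u) > 0"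
        if "0 < u" for u
      proof -
        have u: "u \<ge> 0" using that by simp
        note n = nonneg[OF u] le_one[OF u]
        have "(aL + gLR) * L u \<le> aL + gLR" "(aR + gRL) * R u \<le> aR + gRL"
          using n pos by (auto intro!: mult_left_le)
        then have "C u * (k - ((aL + gLR) * L u + (aR + gRL) * R u)) \<ge> 0"
          using n(4) by (intro mult_nonneg_nonneg) (auto simp: k_def)
        moreover have "mL * L u \<ge> 0" "mR * R u > 0" "rho * A u \<ge> 0" using n pos Rpos[OF u] by auto
        ultimately show ?thesis by (intro mult_pos_pos) auto
      qed
    qed
    then have "0 < C s * exp (k * s)" using init(4) by simp
    then show ?thesis by (simp add: zero_less_mult_iff)
  qed
  have "L 0 * exp (mL * 0) < L t * exp (mL * t)"
  proof (rule deriv_pos_imp_less[OF t order_refl])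
    show "((\<lambda>t. L t * exp (mL * t)) has_real_derivative
        (aL * L u * C u + gRL * R u * C u + dL * A u * L u) * exp (mL * u)) (at u within {0..})" if "u \<ge> 0" for u
      by (rule derivative_eq_intros DL that refl | simp)+ (simp add: algebra_simps)
    show "(aL * L u * C u + gRL * R u * C u + dL * A u * L u) * exp (mL * u) > 0" if "0 < u" for u
    proof -
      have "aL * L u * C u \<ge> 0" "gRL * R u * C u > 0" "dL * A u * L u \<ge> 0"
        using nonneg[of u] that pos Rpos[of u] Cpos[of u] by auto
      then show ?thesis by (intro mult_pos_pos) auto
    qed
  qed
  then have "0 < L t * exp (mL * t)" using init(1) by simp
  then show "L t > 0" by (simp add: zero_less_mult_iff)
  show "R t > 0" "C t > 0" using Rpos Cpos t by auto
qed

lemma pos_if_radicals_nonzero: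
  assumes "L 0 \<noteq> 0 \<or> R 0 \<noteq> 0" and t: "t > 0"
  shows "L t > 0 \<and> R t > 0"
proof (cases "R 0 > 0")
  case True
  then show ?thesis using pos_if_R_pos t by auto
next
  case False
  interpret sw: radicalization_orbit aR aL mR mL gLR gRL dR dL rho R L A C by (rule swap)
  show ?thesis using sw.pos_if_R_pos t False assms init by auto
qed

end

section \<open>Subcritical decay\<close>

context radicalization_orbit
begin

context
  fixes w1 w2 lam :: real
  assumes w: "w1 > 0" "w2 > 0" and lam: "lam > 0" "lam \<le> 1"
    and eig: "w1 * aL + w2 * gLR = lam * mL * w1" "w1 * gRL + w2 * aR = lam * mR * w2"
begin

definition W where "W t = w1 * L t + w2 * R t"

text \<open>Since \<open>(w1, w2)\<close> is a left eigenvector, the recruitment gains collapse to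
  \<open>lam * C\<close> times the weighted removal term.\<close>

lemma DW:
  assumes "t \<ge> 0"
  shows "(W has_real_derivative (lam * C t - 1) * (w1 * mL * L t + w2 * mR * R t)
    + A t * (w1 * dL * L t + w2 * dR * R t)) (at t within {0..})"
proof -
  have "(W has_real_derivative C t * L t * (w1 * aL + w2 * gLR) + C t * R t * (w1 * gRL + w2 * aR)
    - (w1 * mL * L t + w2 * mR * R t) + A t * (w1 * dL * L t + w2 * dR * R t)) (at t within {0..})"
    unfolding W_def[abs_def]
    by (rule derivative_eq_intros DL DR assms refl)+ (simp add: algebra_simps)
  then show ?thesis unfolding eig by (simp add: algebra_simps)
qed

text \<open>As \<open>lam \<le> 1\<close> and \<open>C \<le> 1 - L - R\<close>, the factor
  \<open>1 - lam * C\<close> is at least \<open>L + R\<close>, hence at least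
  \<open>W / (w1 + w2)\<close>. The resulting quadratic damping also covers the critical value
  \<open>lam = 1\<close>, where no linear decay rate is available.\<close>

lemma W_decay:
  assumes "t \<ge> 0"
  shows "(lam * C t - 1) * (w1 * mL * L t + w2 * mR * R t) + A t * (w1 * dL * L t + w2 * dR * R t)
    \<le> A t * (dL + dR) * W t - min mL mR / (w1 + w2) * (W t)\<^sup>2"
proof -
  note n = nonneg[OF assms]
  have W0: "W t \<ge> 0" using n w by (simp add: W_def)
  have "W t \<le> (w1 + w2) * (L t + R t)"
    using n w by (simp add: W_def algebra_simps)
  then have "W t / (w1 + w2) \<le> L t + R t" using w by (simp add: field_simps)
  moreover have "lam * C t \<le> C t" using lam n by (simp add: mult_left_le_one_le)
  ultimately have "W t / (w1 + w2) \<le> 1 - lam * C t"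
    using C_eq[of t] n by linarith
  moreover have "min mL mR * W t \<le> w1 * mL * L t + w2 * mR * R t"
  proof -
    have "min mL mR * (w1 * L t) \<le> mL * (w1 * L t)" "min mL mR * (w2 * R t) \<le> mR * (w2 * R t)"
      using n w by (auto intro!: mult_right_mono)
    then show ?thesis by (simp add: W_def algebra_simps)
  qed
  ultimately have "(W t / (w1 + w2)) * (min mL mR * W t) \<le> (1 - lam * C t) * (w1 * mL * L t + w2 * mR * R t)"
    using W0 w pos by (intro mult_mono') auto
  moreover have "A t * (w1 * dL * L t + w2 * dR * R t) \<le> A t * ((dL + dR) * W t)"
    using n w pos by (intro mult_left_mono) (auto simp: W_def algebra_simps)
  ultimately show ?thesis by (simp add: power2_eq_square algebra_simps)
qed

text \<open>The possible growth \<open>A * (dL + dR) * W\<close> is absorbed by the factor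
  \<open>exp ((dL + dR) / rho * A)\<close>, because \<open>A' \<le> - rho * A\<close>. The product
  is therefore nonincreasing.\<close>

lemma W_bound:
  assumes "t \<ge> 0"
  shows "W t \<le> W 0 * exp ((dL + dR) / rho)"
proof -
  have W0: "W s \<ge> 0" if "s \<ge> 0" for s using nonneg[OF that] w by (simp add: W_def)
  have "W t * exp ((dL + dR) / rho * A t) \<le> W 0 * exp ((dL + dR) / rho * A 0)"
  proof (rule deriv_nonpos_imp_le[OF assms order_refl])
    fix s :: real assume s: "s \<ge> 0"
    let ?W' = "(lam * C s - 1) * (w1 * mL * L s + w2 * mR * R s) + A s * (w1 * dL * L s + w2 * dR * R s)"
    let ?A' = "- dL * A s * L s - dR * A s * R s - rho * A s"
    show "((\<lambda>t. W t * exp ((dL + dR) / rho * A t)) has_real_derivative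
        (?W' + W s * ((dL + dR) / rho * ?A')) * exp ((dL + dR) / rho * A s)) (at s within {0..})"
      by (rule derivative_eq_intros DW DA s refl)+ (simp add: algebra_simps)
  next
    fix s :: real assume "0 < s"
    then have s: "s \<ge> 0" by simp
    note n = nonneg[OF s]
    let ?W' = "(lam * C s - 1) * (w1 * mL * L s + w2 * mR * R s) + A s * (w1 * dL * L s + w2 * dR * R s)"
    let ?A' = "- dL * A s * L s - dR * A s * R s - rho * A s"
    have "min mL mR / (w1 + w2) * (W s)\<^sup>2 \<ge> 0" using w pos by simp
    then have "?W' \<le> A s * (dL + dR) * W s" using W_decay[OF s] by linarith
    moreover have "dL * A s * L s \<ge> 0" "dR * A s * R s \<ge> 0" using n pos by simp_all
    then have "?A' \<le> - rho * A s" by linarith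
    then have "W s * ((dL + dR) / rho * ?A') \<le> W s * ((dL + dR) / rho * (- rho * A s))"
      using W0[OF s] pos by (intro mult_left_mono) auto
    moreover have "W s * ((dL + dR) / rho * (- rho * A s)) = - (A s * (dL + dR) * W s)"
      using pos by simp
    ultimately have "?W' + W s * ((dL + dR) / rho * ?A') \<le> 0" by linarith
    then show "(?W' + W s * ((dL + dR) / rho * ?A')) * exp ((dL + dR) / rho * A s) \<le> 0"
      by (intro mult_nonpos_nonneg) auto
  qed
  moreover have "W t * 1 \<le> W t * exp ((dL + dR) / rho * A t)"
    using W0[OF assms] nonneg[OF assms] pos by (intro mult_left_mono) auto
  moreover have "W 0 * exp ((dL + dR) / rho * A 0) \<le> W 0 * exp ((dL + dR) / rho)"
  proof (rule mult_left_mono)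
    have "(dL + dR) / rho * A 0 \<le> (dL + dR) / rho * 1"
      using le_one[of 0] pos by (intro mult_left_mono) auto
    then show "exp ((dL + dR) / rho * A 0) \<le> exp ((dL + dR) / rho)" by simp
  qed (use W0 in simp)
  ultimately show ?thesis by linarith
qed

text \<open>The Lyapunov stability estimate, obtained by comparing \<open>W\<close> with
  \<open>L + R\<close> from both sides.\<close>

lemma radicals_bound:
  assumes "t \<ge> 0"
  shows "L t + R t \<le> (w1 + w2) / min w1 w2 * exp ((dL + dR) / rho) * (L 0 + R 0)"
proof -
  have lo: "min w1 w2 * (L s + R s) \<le> W s" and hi: "W s \<le> (w1 + w2) * (L s + R s)" if "s \<ge> 0" for s
    using nonneg[OF that] w by (auto simp: W_def algebra_simps min_def mult_right_mono add_mono)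
  have "W 0 * exp ((dL + dR) / rho) \<le> (w1 + w2) * (L 0 + R 0) * exp ((dL + dR) / rho)"
    using hi[of 0] by simp
  then have "min w1 w2 * (L t + R t) \<le> (w1 + w2) * (L 0 + R 0) * exp ((dL + dR) / rho)"
    using lo[OF assms] W_bound[OF assms] by linarith
  then show ?thesis using w by (simp add: field_simps)
qed

lemma radicals_tendsto_0: "(L \<longlongrightarrow> 0) at_top" "(R \<longlongrightarrow> 0) at_top"
proof -
  let ?W' = "\<lambda>t. (lam * C t - 1) * (w1 * mL * L t + w2 * mR * R t) + A t * (w1 * dL * L t + w2 * dR * R t)"
  have ev_pos: "\<forall>\<^sub>F t in at_top. t > (0::real)" by (rule eventually_gt_at_top)
  have W0: "W s \<ge> 0" if "s \<ge> 0" for s using nonneg[OF that] w by (simp add: W_def)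
  have Wle: "W s \<le> w1 + w2" if "s \<ge> 0" for s
    using nonneg[OF that] le_one[OF that] w by (auto simp: W_def mult_left_le intro!: add_mono)
  have ev_le: "\<forall>\<^sub>F t in at_top. W t \<le> e" if e: "e > 0" for e
  proof -
    \<comment> \<open>Half of the quadratic damping at level \<open>e\<close>; the other half pays
      for the vanishing \<open>A\<close> term.\<close>
    define d where "d = min mL mR / (w1 + w2) * e\<^sup>2 / 2"
    have d: "d > 0" using w pos e by (simp add: d_def)
    have d2: "min mL mR / (w1 + w2) * e\<^sup>2 = 2 * d"
      unfolding d_def mult_2 by (rule field_sum_of_halves[symmetric])
    have der: "\<forall>\<^sub>F t in at_top. (W has_real_derivative ?W' t) (at t)"
      using ev_pos
    proof eventually_elim
      case (elim t)
      then show ?case using DW[of t] at_within_interior[of t "{0..}"] by simp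
    qed
    have "\<forall>\<^sub>F t in at_top. e \<le> W t \<longrightarrow> ?W' t \<le> - d"
      using ev_pos eventually_A_mult_less[OF d, of "(dL + dR) * (w1 + w2)"]
    proof eventually_elim
      case (elim t)
      show ?case
      proof
        assume "e \<le> W t"
        then have "min mL mR / (w1 + w2) * e\<^sup>2 \<le> min mL mR / (w1 + w2) * (W t)\<^sup>2"
          using e w pos by (intro mult_left_mono power_mono) auto
        then have "2 * d \<le> min mL mR / (w1 + w2) * (W t)\<^sup>2" unfolding d2 .
        moreover have "A t * (dL + dR) * W t \<le> A t * (dL + dR) * (w1 + w2)"
          using Wle[of t] nonneg[of t] elim pos by (intro mult_left_mono) auto
        ultimately have "A t * (dL + dR) * W t - min mL mR / (w1 + w2) * (W t)\<^sup>2 \<le> A t * (dL + dR) * (w1 + w2) - 2 * d"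
          by (rule diff_mono[rotated])
        also have "\<dots> \<le> - d" using elim(2) by (simp add: mult.assoc)
        finally show "?W' t \<le> - d"
          using W_decay[OF less_imp_le[OF elim(1)]] by (rule order_trans[rotated])
      qed
    qed
    from eventually_le_if_decreasing_above[OF der this d] show ?thesis .
  qed
  have ev: "\<forall>\<^sub>F t in at_top. W t < e" if "e > 0" for e
  proof -
    from that have "e / 2 > 0" by simp
    from ev_le[OF this] show ?thesis by eventually_elim (use that in linarith)
  qed
  show "(L \<longlongrightarrow> 0) at_top"
  proof (rule tendstoI)
    fix e :: real assume "e > 0"
    then have "w1 * e > 0" using w by simp
    from ev[OF this] ev_pos show "\<forall>\<^sub>F t in at_top. dist (L t) 0 < e"
    proof eventually_elim
      case (elim t)
      then have "w2 * R t \<ge> 0" using nonneg[of t] w by simp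
      with elim have "w1 * L t < w1 * e" unfolding W_def by linarith
      then show ?case using w nonneg[of t] elim by simp
    qed
  qed
  show "(R \<longlongrightarrow> 0) at_top"
  proof (rule tendstoI)
    fix e :: real assume "e > 0"
    then have "w2 * e > 0" using w by simp
    from ev[OF this] ev_pos show "\<forall>\<^sub>F t in at_top. dist (R t) 0 < e"
    proof eventually_elim
      case (elim t)
      then have "w1 * L t \<ge> 0" using nonneg[of t] w by simp
      with elim have "w2 * R t < w2 * e" unfolding W_def by linarith
      then show ?case using w nonneg[of t] elim by simp
    qed
  qed
qed

end
end

section \<open>Ratio and total of the radical shares\<close>

text \<open>With \<open>x = ln (L / R)\<close> this is the weighted mean
  \<open>(a * L + b * R) / (L + R)\<close>: a per-capita rate of the whole radical population as a
  function of its composition.\<close>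

definition avg :: "real \<Rightarrow> real \<Rightarrow> real \<Rightarrow> real" where
  "avg a b x = (a * exp x + b) / (exp x + 1)"

lemma continuous_on_avg [continuous_intros]: "continuous_on X (avg a b)"
  unfolding avg_def[abs_def]
  by (intro continuous_intros) (smt (verit) exp_gt_zero)

lemma avg_mono:
  assumes "a \<le> c" "b \<le> d" shows "avg a b x \<le> avg c d x"
  unfolding avg_def by (intro divide_right_mono add_mono mult_right_mono assms) (auto simp: add_nonneg_nonneg)

lemma avg_same [simp]: "avg a a x = a"
proof -
  have "exp x + 1 \<noteq> 0" by (smt (verit) exp_gt_zero)
  then show ?thesis by (simp add: avg_def field_simps)
qed

lemma avg_bounds: "min a b \<le> avg a b x" "avg a b x \<le> max a b"
  using avg_mono[of "min a b" a "min a b" b x] avg_mono[of a "max a b" b "max a b" x] by simp_all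

lemma avg_pos: "a > 0 \<Longrightarrow> b > 0 \<Longrightarrow> avg a b x > 0"
  using avg_bounds(1)[of a b x] by linarith

text \<open>\<open>rs\<close> is the ratio \<open>L / R\<close> and \<open>Cs\<close> the centrist
  share at the endemic equilibrium; \<open>eqL\<close> and \<open>eqR\<close> are the equilibrium
  equations at \<open>A = 0\<close>, divided by the value of \<open>R\<close>. Positivity is asked
  for \<open>t > 0\<close> only, since one group may be empty at the start.\<close>

locale endemic_orbit = radicalization_orbit +
  fixes rs Cs :: real
  assumes rs: "rs > 0" and Cs: "0 < Cs" "Cs < 1"
    and eqL: "Cs * (aL * rs + gRL) = mL * rs"
    and eqR: "Cs * (aR + gLR * rs) = mR"
    and LR_pos: "t > 0 \<Longrightarrow> L t > 0" "t > 0 \<Longrightarrow> R t > 0"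
begin

definition "xs = ln rs"
definition "Ss = 1 - Cs"
definition "xi t = ln (L t / R t)"
definition "S t = L t + R t"
text \<open>\<open>kap\<close>, \<open>mu\<close> and \<open>del\<close> are the mean recruitment,
  removal and reactivation rates in the equation
  \<open>S' = S * (C * kap - mu + A * del)\<close>.\<close>

definition "kap = avg (aL + gLR) (aR + gRL)"
definition "mu = avg mL mR"
definition "del = avg dL dR"
text \<open>Chosen so that \<open>xi' = D - C * q xi + A * (dL - dR)\<close>; the nullcline of
  \<open>xi\<close> at \<open>A = 0\<close> is \<open>C = D / q xi\<close> wherever \<open>q\<close>
  is nonzero.\<close>

definition "q x = gLR * exp x - gRL * exp (- x) - aL + aR"
definition "D = mR - mL"
text \<open>The Volterra function of predator-prey theory, with its minimum 0 at
  \<open>Ss\<close>.\<close>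

definition "vol s = s - Ss - Ss * ln (s / Ss)"

lemma swap_endemic: "endemic_orbit aR aL mR mL gLR gRL dR dL rho R L A C (1 / rs) Cs"
proof -
  interpret sw: radicalization_orbit aR aL mR mL gLR gRL dR dL rho R L A C by (rule swap)
  show ?thesis
    using rs Cs eqL eqR LR_pos by unfold_locales (auto simp: field_simps)
qed

lemma exp_xs: "exp xs = rs" using rs by (simp add: xs_def)

lemma Ss_pos: "Ss > 0" using Cs by (simp add: Ss_def)

lemma exp_xi: "t > 0 \<Longrightarrow> exp (xi t) = L t / R t"
  using LR_pos by (simp add: xi_def)

lemma S_pos: "t > 0 \<Longrightarrow> S t > 0"
  using LR_pos[of t] by (simp add: S_def)

lemma S_le_1: "t > 0 \<Longrightarrow> S t \<le> 1"
  using le_one[of t] by (simp add: S_def)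

lemma C_eq_S: "C t = 1 - S t - A t"
  by (simp add: S_def C_eq)

lemma S_avg: "t > 0 \<Longrightarrow> S t * avg a b (xi t) = a * L t + b * R t"
proof -
  assume t: "t > 0"
  note p = LR_pos[OF t]
  have "avg a b (xi t) = ((a * L t + b * R t) / R t) / ((L t + R t) / R t)"
    using p unfolding avg_def exp_xi[OF t] by (simp add: add_divide_distrib)
  also have "\<dots> = (a * L t + b * R t) / (L t + R t)" using p by simp
  finally show ?thesis using p by (simp add: S_def)
qed

lemma DL_at: "t > 0 \<Longrightarrow> (L has_real_derivative
      aL * L t * C t + gRL * R t * C t + dL * A t * L t - mL * L t) (at t)"
  and DR_at: "t > 0 \<Longrightarrow> (R has_real_derivative
      aR * R t * C t + gLR * L t * C t + dR * A t * R t - mR * R t) (at t)"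
  and DC_at: "t > 0 \<Longrightarrow> (C has_real_derivative
    - C t * ((aL + gLR) * L t + (aR + gRL) * R t) + mL * L t + mR * R t + rho * A t) (at t)"
  using DL[of t] DR[of t] DC[of t] at_within_interior[of t "{0..}"] by simp_all

lemma Dxi:
  assumes t: "t > 0"
  shows "(xi has_real_derivative D - C t * q (xi t) + A t * (dL - dR)) (at t)"
proof -
  note p = LR_pos[OF t]
  have "((\<lambda>t. ln (L t) - ln (R t)) has_real_derivative
      D - C t * q (xi t) + A t * (dL - dR)) (at t)"
    using p by (auto intro!: derivative_eq_intros DL_at DR_at t
      simp: q_def D_def exp_minus exp_xi[OF t] field_simps)
  then show ?thesis
    by (rule has_field_derivative_transform_within_open[of _ _ _ "{0<..}"])
      (use t LR_pos in \<open>auto simp: xi_def ln_div less_imp_neq[THEN not_sym]\<close>)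
qed

lemma DS:
  assumes t: "t > 0"
  shows "(S has_real_derivative S t * (C t * kap (xi t) - mu (xi t) + A t * del (xi t))) (at t)"
proof -
  have "S t * (C t * kap (xi t) - mu (xi t) + A t * del (xi t))
    = C t * (S t * kap (xi t)) - S t * mu (xi t) + A t * (S t * del (xi t))"
    by (simp add: algebra_simps)
  also have "\<dots> = aL * L t * C t + gRL * R t * C t + dL * A t * L t - mL * L t
    + (aR * R t * C t + gLR * L t * C t + dR * A t * R t - mR * R t)"
    unfolding kap_def mu_def del_def S_avg[OF t] by (simp add: algebra_simps)
  finally show ?thesis
    unfolding S_def[abs_def] using DERIV_add[OF DL_at DR_at, OF t t] by simp
qed

text \<open>The derivative \<open>1 - Ss / S\<close> of \<open>vol\<close> cancels the factor
  \<open>S\<close> in \<open>S'\<close>, so no degeneracy at \<open>S = 0\<close> remains.\<close>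

lemma Dvol:
  assumes t: "t > 0"
  shows "((\<lambda>t. vol (S t)) has_real_derivative
    (S t - Ss) * (C t * kap (xi t) - mu (xi t) + A t * del (xi t))) (at t)"
  unfolding vol_def
  by (rule derivative_eq_intros DS t refl | use S_pos[OF t] Ss_pos in \<open>simp add: field_simps\<close>)+

lemma vol_Ss: "vol Ss = 0"
  using Ss_pos by (simp add: vol_def)

lemma isCont_vol: "isCont vol Ss"
  unfolding vol_def using Ss_pos by (auto intro!: continuous_intros)

text \<open>This is \<open>y\<^sup>2 - 1 - ln (y\<^sup>2) \<ge> (y - 1)\<^sup>2\<close> at \<open>y = sqrt (s / Ss)\<close>; unlike \<open>vol\<close>, the lower
  bound is continuous at \<open>s = 0\<close>.\<close>
lemma vol_ge:
  assumes "s > 0"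
  shows "Ss * (sqrt (s / Ss) - 1)\<^sup>2 \<le> vol s"
proof -
  define y where "y = sqrt (s / Ss)"
  have y: "y > 0" "s = Ss * y\<^sup>2" using assms Ss_pos by (auto simp: y_def)
  have "ln (y\<^sup>2) = 2 * ln y" using y by (simp add: ln_realpow)
  then have "vol s = Ss * (y\<^sup>2 - 1 - 2 * ln y)"
    using y Ss_pos by (simp add: vol_def algebra_simps)
  moreover have "(y - 1)\<^sup>2 \<le> y\<^sup>2 - 1 - 2 * ln y"
    using ln_le_minus_one[OF y(1)] by (simp add: power2_diff)
  ultimately show ?thesis
    using Ss_pos by (simp add: y_def)
qed

section \<open>Averaged rates, the nullcline function \<open>q\<close>, and the equilibrium in the
  new coordinates\<close>

lemma kap_pos: "kap x > 0"
  using pos by (auto simp: kap_def intro!: avg_pos add_pos_pos)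

lemma continuous_kap_mu_del [continuous_intros]:
  "continuous_on X kap" "continuous_on X mu" "continuous_on X del"
  unfolding kap_def mu_def del_def by (rule continuous_on_avg)+

lemma continuous_q [continuous_intros]: "continuous_on X q"
  unfolding q_def[abs_def] by (intro continuous_intros)

lemma q_strict_mono: "x < y \<Longrightarrow> q x < q y"
  using pos unfolding q_def
  by (smt (verit) exp_less_cancel_iff mult_less_cancel_left_pos)

lemma q_less_iff: "q x < q y \<longleftrightarrow> x < y"
  using q_strict_mono by (metis linorder_less_linear order_less_asym)

lemma q_le_iff: "q x \<le> q y \<longleftrightarrow> x \<le> y"
  using q_less_iff by (simp add: linorder_not_less[symmetric])

lemma q_surj: "\<exists>x. q x = v"
proof -
  have "\<exists>x\<ge>0. q x \<ge> v"
  proof -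
    \<comment> \<open>By \<open>exp x \<ge> 1 + x\<close>, this \<open>x\<close> already makes
      \<open>gLR * exp x\<close> large enough; the lower side uses \<open>gRL * exp x\<close> at
      \<open>- x\<close> in the same way.\<close>
    define x where "x = \<bar>v + gRL + aL\<bar> / gLR"
    have x0: "x \<ge> 0" using pos by (simp add: x_def)
    have "gLR * x \<le> gLR * exp x"
      using pos exp_ge_add_one_self[of x] by (intro mult_left_mono) linarith+
    moreover have "gRL * exp (- x) \<le> gRL" using x0 pos by (auto intro!: mult_left_le)
    moreover have "gLR * x = \<bar>v + gRL + aL\<bar>" using pos by (simp add: x_def)
    ultimately have "q x \<ge> v" unfolding q_def using pos by linarith
    with x0 show ?thesis by blast
  qed
  moreover have "\<exists>x\<le>0. q x \<le> v"
  proof -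
    define x where "x = \<bar>gLR + aR - v\<bar> / gRL"
    have x0: "x \<ge> 0" using pos by (simp add: x_def)
    have "gRL * x \<le> gRL * exp x"
      using pos exp_ge_add_one_self[of x] by (intro mult_left_mono) linarith+
    moreover have "gLR * exp (- x) \<le> gLR" using x0 pos by (auto intro!: mult_left_le)
    moreover have "gRL * x = \<bar>gLR + aR - v\<bar>" using pos by (simp add: x_def)
    ultimately have "q (- x) \<le> v" unfolding q_def using pos by (simp; linarith)
    with x0 show ?thesis by (intro exI[of _ "- x"]) simp
  qed
  ultimately obtain a b where "a \<le> 0" "0 \<le> b" "q a \<le> v" "v \<le> q b" by blast
  then show ?thesis using IVT'[of q a v b] continuous_q by fastforce
qed

lemma q_xs: "Cs * q xs = D"
proof -
  have "Cs * q xs = Cs * (aR + gLR * rs) - (Cs * (aL * rs + gRL)) / rs"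
    using rs by (simp add: q_def exp_xs exp_minus field_simps)
  then show ?thesis unfolding eqL eqR using rs by (simp add: D_def)
qed

lemma mu_xs: "mu xs = Cs * kap xs"
proof -
  have "Cs * ((aL + gLR) * rs + (aR + gRL)) = mL * rs + mR"
    using eqL eqR by (simp add: algebra_simps)
  then show ?thesis by (simp add: mu_def kap_def avg_def exp_xs)
qed

section \<open>Eventual bounds for \<open>C\<close> and for the log-ratio \<open>xi\<close>\<close>

lemma ev_pos: "\<forall>\<^sub>F t in at_top. t > (0::real)" by (rule eventually_gt_at_top)

text \<open>The inflow into \<open>C\<close> is at least \<open>m * (1 - C)\<close> and the outflow
  at most \<open>k * C\<close>, so \<open>C\<close> grows at a fixed rate while it is small.\<close>

lemma C_bounded_below: "\<exists>c>0. \<forall>\<^sub>F t in at_top. c \<le> C t"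
proof -
  define m where "m = min (min mL mR) rho"
  define k where "k = aL + gLR + (aR + gRL)"
  have m: "m > 0" "m \<le> mL" "m \<le> mR" "m \<le> rho" and k: "k > 0" using pos by (auto simp: m_def k_def)
  \<comment> \<open>Below this level \<open>C' \<ge> m - C * (k + m) \<ge> m / 2\<close>.\<close>
  define c where "c = m / (2 * (k + m))"
  have c: "c > 0" "c * (k + m) = m / 2"
    using m k by (simp_all add: c_def field_split_simps)
  let ?C' = "\<lambda>t. - C t * ((aL + gLR) * L t + (aR + gRL) * R t) + mL * L t + mR * R t + rho * A t"
  have der: "\<forall>\<^sub>F t in at_top. ((\<lambda>t. - C t) has_real_derivative - ?C' t) (at t)"
    using ev_pos by eventually_elim (rule DERIV_minus[OF DC_at])
  have "\<forall>\<^sub>F t in at_top. - c \<le> - C t \<longrightarrow> - ?C' t \<le> - (m / 2)"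
    using ev_pos
  proof eventually_elim
    case (elim t)
    then have t: "t \<ge> 0" by simp
    note n = nonneg[OF t] le_one[OF t]
    show ?case
    proof
      assume "- c \<le> - C t"
      then have "C t * (k + m) \<le> c * (k + m)" using k m by (intro mult_right_mono) auto
      with c have "C t * k + C t * m \<le> m / 2" by (simp add: algebra_simps)
      moreover have "(aL + gLR) * L t \<le> aL + gLR" "(aR + gRL) * R t \<le> aR + gRL"
        using n pos by (auto intro!: mult_left_le)
      then have "C t * ((aL + gLR) * L t + (aR + gRL) * R t) \<le> C t * k"
        using n by (intro mult_left_mono) (auto simp: k_def)
      moreover have "m * L t \<le> mL * L t" "m * R t \<le> mR * R t" "m * A t \<le> rho * A t"
        using n m by (auto intro!: mult_right_mono)
      moreover have "m * L t + m * R t + m * A t = m - C t * m"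
        by (simp add: C_eq algebra_simps)
      ultimately show "- ?C' t \<le> - (m / 2)" by linarith
    qed
  qed
  from eventually_le_if_decreasing_above[OF der this] m
  show ?thesis using c(1) by auto
qed

text \<open>Beyond \<open>b\<close> the restoring term \<open>C * q xi\<close> is at least
  \<open>c * q b > D\<close>. Half of the gap is kept as drift and the other half absorbs the
  \<open>A\<close> term.\<close>

lemma xi_le_upper:
  assumes c: "c > 0" "\<forall>\<^sub>F t in at_top. c \<le> C t" and b: "q b > 0" "D < c * q b"
  shows "\<forall>\<^sub>F t in at_top. xi t \<le> b"
proof -
  define e where "e = (c * q b - D) / 2"
  have e: "e > 0" using b by (simp add: e_def)
  have der: "\<forall>\<^sub>F t in at_top. (xi has_real_derivative D - C t * q (xi t) + A t * (dL - dR)) (at t)"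
    using ev_pos by eventually_elim (rule Dxi)
  have "\<forall>\<^sub>F t in at_top. b \<le> xi t \<longrightarrow> D - C t * q (xi t) + A t * (dL - dR) \<le> - e"
    using c(2) eventually_A_mult_less[OF e, of "dL - dR"]
  proof eventually_elim
    case (elim t)
    show ?case
    proof
      assume "b \<le> xi t"
      then have "c * q b \<le> C t * q (xi t)"
        using q_le_iff[of b "xi t"] elim c(1) b(1) by (intro mult_mono) auto
      then show "D - C t * q (xi t) + A t * (dL - dR) \<le> - e" using elim(2) unfolding e_def by argo
    qed
  qed
  from eventually_le_if_decreasing_above[OF der this e] show ?thesis .
qed

end

section \<open>Convergence to the endemic equilibrium\<close>

context endemic_orbit
begin

text \<open>Exchanging the groups reflects the log-ratio, so upper bounds for the exchanged orbit
  are lower bounds for \<open>xi\<close>.\<close>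

lemma swap_coords:
  assumes "t > 0"
  shows "endemic_orbit.xi R L t = - xi t" "endemic_orbit.xs (1 / rs) = - xs"
    "endemic_orbit.q aR aL gLR gRL x = - q (- x)"
proof -
  interpret sw: endemic_orbit aR aL mR mL gLR gRL dR dL rho R L A C "1 / rs" Cs by (rule swap_endemic)
  show "sw.xi t = - xi t" using LR_pos[OF assms] by (simp add: sw.xi_def xi_def ln_div)
  show "sw.xs = - xs" using rs by (simp add: sw.xs_def xs_def ln_div)
  show "sw.q x = - q (- x)" by (simp add: sw.q_def q_def)
qed

text \<open>Here \<open>q xs = 0\<close>, so \<open>xi' = - C * q xi\<close> up to a vanishing term.
  With \<open>C\<close> bounded below, this pushes \<open>xi\<close> towards \<open>xs\<close>
  whatever \<open>S\<close> does.\<close>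

lemma xi_tendsto_balanced:
  assumes "D = 0"
  shows "(xi \<longlongrightarrow> xs) at_top"
proof (rule tendstoI)
  interpret sw: endemic_orbit aR aL mR mL gLR gRL dR dL rho R L A C "1 / rs" Cs by (rule swap_endemic)
  have q0: "q xs = 0" using q_xs Cs assms by simp
  have sD: "sw.D = 0" using assms unfolding sw.D_def D_def by simp
  obtain c where c: "c > 0" "\<forall>\<^sub>F t in at_top. c \<le> C t" using C_bounded_below by blast
  fix e :: real assume "e > 0"
  have u: "\<forall>\<^sub>F t in at_top. xi t \<le> xs + e / 2"
    by (rule xi_le_upper[OF c]) (use q_strict_mono[of xs "xs + e / 2"] \<open>e > 0\<close> q0 assms c in auto)
  \<comment> \<open>The lower bound \<open>xs - e / 2 \<le> xi t\<close>, read as an upper bound for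
    the exchanged orbit.\<close>
  have "\<forall>\<^sub>F t in at_top. sw.xi t \<le> sw.xs + e / 2"
    by (rule sw.xi_le_upper[OF c])
      (use q_strict_mono[of "xs - e / 2" xs] \<open>e > 0\<close> q0 sD swap_coords[of 1] c in
        \<open>auto simp: mult_pos_neg\<close>)
  with u ev_pos show "\<forall>\<^sub>F t in at_top. dist (xi t) xs < e"
  proof eventually_elim
    case (elim t)
    then show ?case using swap_coords[of t] \<open>e > 0\<close> by (auto simp: dist_real_def)
  qed
qed

text \<open>As \<open>xi\<close> tends to \<open>xs\<close>, the equation of \<open>S\<close>
  becomes asymptotically logistic, and \<open>vol\<close> is a Lyapunov function up to a vanishing
  error.\<close>

lemma S_tendsto_balanced:
  assumes "D = 0"
  shows "(S \<longlongrightarrow> Ss) at_top"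
proof (rule Lyapunov_tendsto)
  define m where "m = min (aL + gLR) (aR + gRL)"
  have m: "m > 0" "m \<le> kap x" for x
    using pos avg_bounds(1)[of "aL + gLR" "aR + gRL" x] by (auto simp: m_def kap_def)
  let ?U = "\<lambda>s. Ss * (sqrt (s / Ss) - 1)\<^sup>2" and ?W = "\<lambda>s. m * (s - Ss)\<^sup>2"
  \<comment> \<open>What is left of the growth rate of \<open>S\<close> after splitting off
    \<open>- kap * (S - Ss)\<close>; it tends to 0 by \<open>mu_xs\<close>.\<close>
  let ?r = "\<lambda>t. Cs * kap (xi t) - mu (xi t) + A t * (del (xi t) - kap (xi t))"
  show "compact {0..1::real}" "Ss \<in> {0..1}" using Cs by (auto simp: Ss_def)
  show "\<forall>\<^sub>F t in at_top. S t \<in> {0..1}"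
    using ev_pos by eventually_elim (use S_pos S_le_1 in \<open>auto intro: less_imp_le\<close>)
  show "continuous_on {0..1} ?U" "continuous_on {0..1} ?W"
    using Ss_pos by (auto intro!: continuous_intros)
  show "?U s > 0" if "s \<noteq> Ss" for s
    using that Ss_pos by auto
  show "?W s > 0" if "s \<noteq> Ss" for s
    using that m(1) by simp
  show "isCont vol Ss" "vol Ss = 0" by (rule isCont_vol vol_Ss)+
  show "\<forall>\<^sub>F t in at_top. ?U (S t) \<le> vol (S t)"
    using ev_pos by eventually_elim (rule vol_ge[OF S_pos])
  show "\<forall>\<^sub>F t in at_top. ((\<lambda>t. vol (S t)) has_real_derivative
      (S t - Ss) * (C t * kap (xi t) - mu (xi t) + A t * del (xi t))) (at t)"
    using ev_pos by eventually_elim (rule Dvol)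
  show "\<forall>\<^sub>F t in at_top. (S t - Ss) * (C t * kap (xi t) - mu (xi t) + A t * del (xi t))
      \<le> - ?W (S t) + \<bar>?r t\<bar>"
    using ev_pos
  proof eventually_elim
    case (elim t)
    have "(S t - Ss) * (C t * kap (xi t) - mu (xi t) + A t * del (xi t))
      = - (kap (xi t) * (S t - Ss)\<^sup>2) + (S t - Ss) * ?r t"
      by (simp add: C_eq_S Ss_def power2_eq_square algebra_simps)
    moreover have "m * (S t - Ss)\<^sup>2 \<le> kap (xi t) * (S t - Ss)\<^sup>2"
      using m(2) by (intro mult_right_mono) auto
    moreover have "\<bar>S t - Ss\<bar> \<le> 1" using S_pos[OF elim] S_le_1[OF elim] Ss_pos Cs by (simp add: Ss_def)
    then have "(S t - Ss) * ?r t \<le> \<bar>?r t\<bar>"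
      using mult_right_mono[of "\<bar>S t - Ss\<bar>" 1 "\<bar>?r t\<bar>"] abs_ge_self[of "(S t - Ss) * ?r t"]
      by (simp add: abs_mult)
    ultimately show ?case by linarith
  qed
  have "(?r \<longlongrightarrow> Cs * kap xs - mu xs + 0 * (del xs - kap xs)) at_top"
    by (intro tendsto_intros A_tendsto isCont_tendsto_compose[OF _ xi_tendsto_balanced[OF assms]]
        continuous_on_interior[of UNIV] continuous_kap_mu_del) auto
  then have "(?r \<longlongrightarrow> 0) at_top" by (simp add: mu_xs)
  then show "((\<lambda>t. \<bar>?r t\<bar>) \<longlongrightarrow> 0) at_top" by (rule tendsto_rabs_zero)
qed

text \<open>Where \<open>q\<close> is positive, the nullclines \<open>D / q\<close> and
  \<open>mu / kap\<close> can cross only at \<open>xs\<close>. In the variable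
  \<open>r = exp x\<close>, their difference after cross-multiplication is a positive factor times
  \<open>r - rs\<close>.\<close>

lemma ratio_sign:
  assumes q: "q x > 0"
  shows "x > xs \<Longrightarrow> D / q x < mu x / kap x" "x < xs \<Longrightarrow> mu x / kap x < D / q x"
proof -
  define r where "r = exp x"
  have r: "r > 0" by (simp add: r_def)
  define X where "X = aL * r + gRL"
  define Y where "Y = gLR * r + aR"
  have XY: "X > 0" "Y > 0" using r pos by (auto simp: X_def Y_def add_pos_pos)
  have qr: "q x = (r * Y - X) / r"
    using r unfolding q_def X_def Y_def exp_minus r_def[symmetric] by (simp add: field_simps)
  have h: "mu x / kap x = (mL * r + mR) / (X + Y)"
  proof -
    have "kap x = (X + Y) / (r + 1)" "mu x = (mL * r + mR) / (r + 1)"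
      by (simp_all add: mu_def kap_def avg_def X_def Y_def r_def algebra_simps)
    then show ?thesis using r XY by simp
  qed
  have "q x * (mL * r + mR) - D * (X + Y) = (1 + r) * (mL * r * Y - mR * X) / r"
    using r unfolding qr D_def by (simp add: field_simps)
  \<comment> \<open>This quadratic in \<open>r\<close> has the root \<open>rs\<close> (eliminate
    \<open>Cs\<close> from \<open>eqL\<close> and \<open>eqR\<close>); its leading and constant
    coefficients then determine the other linear factor.\<close>
  also have "mL * r * Y - mR * X = (r - rs) * (mL * gLR * r + mR * gRL / rs)"
  proof -
    have "mL * rs * (aR + gLR * rs) = mR * (aL * rs + gRL)"
      using eqL eqR Cs(1) by (metis mult.assoc mult.commute mult.left_commute)
    then have "mL * aR = mR * aL + mR * gRL / rs - mL * gLR * rs"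
      using rs by (simp add: field_simps)
    then have "r * (mL * aR) = r * (mR * aL + mR * gRL / rs - mL * gLR * rs)" by simp
    then show ?thesis using rs unfolding X_def Y_def by (simp add: field_simps)
  qed
  finally have e: "q x * (mL * r + mR) - D * (X + Y) = (1 + r) / r * (mL * gLR * r + mR * gRL / rs) * (r - rs)"
    by (simp only: times_divide_eq_left times_divide_eq_right mult_ac)
  have p: "(1 + r) / r * (mL * gLR * r + mR * gRL / rs) > 0"
    using r rs pos by (intro mult_pos_pos add_pos_pos divide_pos_pos) auto
  {
    assume "x > xs"
    then have "exp xs < r" by (simp add: r_def)
    then have "r > rs" by (simp add: exp_xs)
    from mult_pos_pos[OF p, of "r - rs"] this have "q x * (mL * r + mR) > D * (X + Y)"
      unfolding e[symmetric] by simp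
    then show "D / q x < mu x / kap x" unfolding h using q XY by (simp add: field_simps)
  next
    assume "x < xs"
    then have "r < exp xs" by (simp add: r_def)
    then have "r < rs" by (simp add: exp_xs)
    from mult_pos_neg[OF p, of "r - rs"] this have "q x * (mL * r + mR) < D * (X + Y)"
      unfolding e[symmetric] by simp
    then show "mu x / kap x < D / q x" unfolding h using q XY by (simp add: field_simps)
  }
qed

text \<open>With \<open>g = D / q\<close> and \<open>h = mu / kap\<close> (the nullclines of \<open>xi\<close> and \<open>S\<close> in terms of \<open>C\<close> at \<open>A = 0\<close>),
  \<open>G = g - Cs\<close>, \<open>H = h - Cs\<close> and \<open>y = Ss - S\<close>, the weight \<open>(H - 2 G) kap / q\<close> of \<open>xi'\<close> completes the
  square: the derivative becomes \<open>- kap ((y - G)\<^sup>2 + G (G - H))\<close>, and \<open>G (G - H) > 0\<close> away from the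
  equilibrium because the nullclines cross only there.\<close>
lemma tendsto_unbalanced:
  assumes D: "D > 0"
  shows "((\<lambda>t. (xi t, S t)) \<longlongrightarrow> (xs, Ss)) at_top"
proof -
  obtain c where c: "c > 0" "\<forall>\<^sub>F t in at_top. c \<le> C t" using C_bounded_below by blast
  have qxs: "q xs = D / Cs" using q_xs Cs by (simp add: field_simps)
  have qxs': "D < q xs" using mult_strict_left_mono[OF Cs(2) D] Cs D by (simp add: qxs less_divide_eq)
  \<comment> \<open>The strip \<open>x1 \<le> xi \<le> x2\<close> traps the orbit. As
    \<open>C \<le> 1\<close>, below \<open>x1\<close> the drift is at least \<open>D / 2\<close> up
    to the \<open>A\<close> term, and \<open>q x2\<close> is large enough for
    \<open>c * q x2 > D\<close>. The points \<open>a\<close> and \<open>b\<close> leave a margin in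
    which \<open>q\<close> stays positive and \<open>Phi\<close> has two-sided derivatives.\<close>
  obtain a where a: "q a = D / 4" using q_surj by blast
  obtain x1 where x1: "q x1 = D / 2" using q_surj by blast
  obtain x2 where x2: "q x2 = 2 * q xs + 2 * D / c" using q_surj by blast
  define b where "b = x2 + 1"
  have "q a < q x1" "q x1 < q xs" using a x1 D qxs' by linarith+
  moreover have "2 * D / c > 0" using D c by simp
  then have "q xs < q x2" using x2 D qxs' by linarith
  ultimately have ord: "a < x1" "x1 < xs" "xs < x2" "x2 < b"
    by (simp_all add: q_less_iff b_def)
  have q_pos: "q x > 0" if "a \<le> x" for x
    using q_le_iff[of a x] that a D by simp
  have xi_upper: "\<forall>\<^sub>F t in at_top. xi t \<le> x2"
  proof (rule xi_le_upper[OF c])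
    have "D < 2 * c * q xs + 2 * D" using qxs' c(1) D by (simp add: add_pos_pos)
    then show "D < c * q x2" using c(1) by (simp add: x2 algebra_simps)
    show "q x2 > 0" using qxs' D c(1) by (simp add: x2 add_pos_pos)
  qed
  have xi_lower: "\<forall>\<^sub>F t in at_top. x1 \<le> xi t"
  proof -
    have der: "\<forall>\<^sub>F t in at_top. ((\<lambda>t. - xi t) has_real_derivative
        - (D - C t * q (xi t) + A t * (dL - dR))) (at t)"
      using ev_pos by eventually_elim (rule DERIV_minus[OF Dxi])
    have "\<forall>\<^sub>F t in at_top. - x1 \<le> - xi t \<longrightarrow> - (D - C t * q (xi t) + A t * (dL - dR)) \<le> - (D / 4)"
      using ev_pos eventually_A_mult_less[of "D / 4" "dR - dL", OF divide_pos_pos[OF D zero_less_numeral]]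
    proof eventually_elim
      case (elim t)
      show ?case
      proof
        assume "- x1 \<le> - xi t"
        then have "q (xi t) \<le> D / 2" using q_le_iff[of "xi t" x1] x1 by simp
        then have "C t * q (xi t) \<le> C t * (D / 2)" using nonneg[of t] elim by (intro mult_left_mono) auto
        also have "\<dots> \<le> D / 2" using nonneg[of t] le_one[of t] elim D by (intro mult_left_le_one_le) auto
        finally show "- (D - C t * q (xi t) + A t * (dL - dR)) \<le> - (D / 4)"
          using elim(2) D by (simp add: algebra_simps)
      qed
    qed
    from eventually_le_if_decreasing_above[OF der this] D show ?thesis by simp
  qed
  \<comment> \<open>The weight \<open>(H - 2 * G) * kap / q\<close>, written without the shifts by
    \<open>Cs\<close>.\<close>
  define f where "f x = (mu x / kap x - 2 * (D / q x) + Cs) * kap x / q x" for x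
  have contf: "continuous_on {a..b} f"
    unfolding f_def using q_pos kap_pos
    by (intro continuous_intros continuous_q continuous_kap_mu_del) (auto simp: less_imp_neq[THEN not_sym])
  \<comment> \<open>The antiderivative of the weight, normalized to vanish at
    \<open>xs\<close>.\<close>
  define Phi where "Phi x = integral {a..x} f - integral {a..xs} f" for x
  have DPhi: "(Phi has_real_derivative f x) (at x)" if "a < x" "x < b" for x
  proof -
    have "(Phi has_real_derivative f x) (at x within {a..b})"
      unfolding Phi_def using integral_has_real_derivative[OF contf, of x] that
      by (auto intro!: derivative_eq_intros)
    then show ?thesis using at_within_interior[of x "{a..b}"] that by simp
  qed
  have Cs_less: "D / q x < Cs" if "x > xs" for x
    using q_strict_mono[OF that] q_pos[of x] that ord qxs Cs by (simp add: field_simps)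
  have Cs_greater: "Cs < D / q x" if "x < xs" "a \<le> x" for x
    using q_strict_mono[OF that(1)] q_pos[of x] that ord qxs Cs by (simp add: field_simps)
  \<comment> \<open>To the right of \<open>xs\<close> both \<open>mu / kap\<close> and
    \<open>Cs\<close> exceed \<open>D / q\<close>; to the left both lie below it. So
    \<open>f\<close> changes sign at \<open>xs\<close>, and \<open>Phi\<close> has its minimum
    there.\<close>
  have f_pos: "f x > 0" if "x > xs" for x
    using Cs_less[OF that] ratio_sign(1)[of x] q_pos[of x] kap_pos[of x] that ord
    unfolding f_def by (intro divide_pos_pos mult_pos_pos) auto
  have f_neg: "f x < 0" if "x < xs" "a \<le> x" for x
    using Cs_greater[OF that] ratio_sign(2)[of x] q_pos[of x] kap_pos[of x] that ord
    unfolding f_def by (intro divide_neg_pos mult_neg_pos) auto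
  have Phi_xs: "Phi xs = 0" by (simp add: Phi_def)
  have contPhi: "continuous_on {x1..x2} Phi"
    by (rule DERIV_atLeastAtMost_imp_continuous_on) (use DPhi ord in \<open>meson order.strict_trans1 order.strict_trans2\<close>)
  have Phi_pos: "Phi x > 0" if x: "x1 \<le> x" "x \<le> x2" "x \<noteq> xs" for x
  proof (cases "x > xs")
    case True
    have "Phi xs < Phi x"
    proof (rule DERIV_pos_imp_increasing_open[OF True])
      fix u assume "xs < u" "u < x"
      then show "\<exists>y. (Phi has_real_derivative y) (at u) \<and> y > 0"
        using DPhi[of u] f_pos[of u] ord x by auto
    qed (use contPhi continuous_on_subset x ord in fastforce)
    then show ?thesis by (simp add: Phi_xs)
  next
    case False
    then have l: "x < xs" using x by simp
    have "Phi xs < Phi x"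
    proof (rule DERIV_neg_imp_decreasing_open[OF l])
      fix u assume "x < u" "u < xs"
      then show "\<exists>y. (Phi has_real_derivative y) (at u) \<and> y < 0"
        using DPhi[of u] f_neg[of u] ord x by auto
    qed (use contPhi continuous_on_subset x ord in fastforce)
    then show ?thesis by (simp add: Phi_xs)
  qed
  define K where "K = {x1..x2} \<times> {0..1::real}"
  \<comment> \<open>\<open>vol\<close> is replaced by its continuous lower bound, because
    \<open>K\<close> contains the edge \<open>S = 0\<close>.\<close>
  define U where "U p = Phi (fst p) + Ss * (sqrt (snd p / Ss) - 1)\<^sup>2" for p
  define V where "V p = Phi (fst p) + vol (snd p)" for p
  define G where "G x = D / q x - Cs" for x
  define H where "H x = mu x / kap x - Cs" for x
  define W where "W p = kap (fst p) * ((Ss - snd p - G (fst p))\<^sup>2 + G (fst p) * (G (fst p) - H (fst p)))" for p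
  \<comment> \<open>The coefficient of \<open>A\<close> in the derivative of \<open>V\<close>, once
    \<open>C\<close> is written as \<open>Cs + (Ss - S) - A\<close>; it is bounded on
    \<open>K\<close>.\<close>
  define E where "E p = f (fst p) * (q (fst p) + (dL - dR)) + (snd p - Ss) * (del (fst p) - kap (fst p))" for p
  have contGH: "continuous_on {x1..x2} G" "continuous_on {x1..x2} H"
    unfolding G_def H_def using q_pos kap_pos ord
    by (intro continuous_intros continuous_q continuous_kap_mu_del; auto simp: less_imp_neq[THEN not_sym])+
  have fstK: "continuous_on K (\<lambda>p. k (fst p))" if "continuous_on {x1..x2} k" for k :: "real \<Rightarrow> real"
    by (rule continuous_on_compose2[OF that continuous_on_fst[OF continuous_on_id]]) (auto simp: K_def)
  have compK: "compact K" unfolding K_def by (intro compact_Times) auto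
  \<comment> \<open>\<open>G\<close> and \<open>G - H\<close> have the same sign: both negative
    right of \<open>xs\<close>, both positive left of it.\<close>
  have GH_pos: "G x * (G x - H x) > 0" if "x1 \<le> x" "x \<noteq> xs" for x
  proof (cases "x > xs")
    case True
    then show ?thesis
      using Cs_less[OF True] ratio_sign(1)[of x] q_pos[of x] that ord
      unfolding G_def H_def by (intro mult_neg_neg) auto
  next
    case False
    then show ?thesis
      using Cs_greater[of x] ratio_sign(2)[of x] q_pos[of x] that ord
      unfolding G_def H_def by (intro mult_pos_pos) auto
  qed
  have G_xs: "G xs = 0" using qxs D Cs by (simp add: G_def)
  have contf': "continuous_on {x1..x2} f"
    by (rule continuous_on_subset[OF contf]) (use ord in auto)
  have "continuous_on K E"
    unfolding E_def
    by (intro continuous_intros fstK contf' continuous_q continuous_kap_mu_del)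
  then have "compact (E ` K)" by (rule compact_continuous_image[OF _ compK])
  then obtain B where "\<And>p. p \<in> K \<Longrightarrow> \<bar>E p\<bar> \<le> B"
    unfolding compact_eq_bounded_closed bounded_iff by auto
  then have B: "E p \<le> B" if "p \<in> K" for p
    using that by (meson abs_le_D1)
  have inK: "\<forall>\<^sub>F t in at_top. (xi t, S t) \<in> K"
    using xi_upper xi_lower ev_pos
    by eventually_elim (use S_pos S_le_1 in \<open>auto simp: K_def intro: less_imp_le\<close>)
  let ?v' = "\<lambda>t. f (xi t) * (D - C t * q (xi t) + A t * (dL - dR))
    + (S t - Ss) * (C t * kap (xi t) - mu (xi t) + A t * del (xi t))"
  show ?thesis
  proof (rule Lyapunov_tendsto[OF compK _ inK, where U = U and V = V and W = W and v' = ?v'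
        and err = "\<lambda>t. A t * B"])
    show "(xs, Ss) \<in> K" using ord Cs by (simp add: K_def Ss_def)
    show "continuous_on K U" unfolding U_def
      using Ss_pos by (intro continuous_intros fstK contPhi) auto
    show "continuous_on K W" unfolding W_def
      by (intro continuous_intros fstK contGH continuous_kap_mu_del)
    show "U p > 0" if "p \<in> K" "p \<noteq> (xs, Ss)" for p
    proof (cases "fst p = xs")
      case True
      then show ?thesis using that Ss_pos by (cases p) (auto simp: U_def Phi_xs)
    next
      case False
      then show ?thesis using that Phi_pos[of "fst p"] Ss_pos
        by (cases p) (auto simp: U_def K_def intro!: add_pos_nonneg)
    qed
    show "W p > 0" if "p \<in> K" "p \<noteq> (xs, Ss)" for p
    proof (cases "fst p = xs")
      case True
      then show ?thesis using that kap_pos by (cases p) (auto simp: W_def G_xs)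
    next
      case False
      then show ?thesis using that GH_pos[of "fst p"] kap_pos
        by (cases p) (auto simp: W_def K_def intro!: add_nonneg_pos mult_pos_pos)
    qed
    show "isCont V (xs, Ss)"
      unfolding V_def
      by (intro continuous_add isCont_o2[OF isCont_fst[OF continuous_ident]] isCont_o2[OF isCont_snd[OF continuous_ident]])
        (use DERIV_isCont[OF DPhi[of xs]] ord isCont_vol in auto)
    show "V (xs, Ss) = 0" by (simp add: V_def Phi_xs vol_Ss)
    show "\<forall>\<^sub>F t in at_top. U (xi t, S t) \<le> V (xi t, S t)"
      using ev_pos by eventually_elim (simp add: U_def V_def vol_ge S_pos)
    show "\<forall>\<^sub>F t in at_top. ((\<lambda>t. V (xi t, S t)) has_real_derivative ?v' t) (at t)"
      using ev_pos xi_lower xi_upper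
    proof eventually_elim
      case (elim t)
      then have "(Phi has_real_derivative f (xi t)) (at (xi t))" using ord by (intro DPhi) auto
      from DERIV_add[OF DERIV_chain2[OF this Dxi[OF elim(1)]] Dvol[OF elim(1)]]
      show ?case by (simp add: V_def)
    qed
    show "\<forall>\<^sub>F t in at_top. ?v' t \<le> - W (xi t, S t) + A t * B"
      using ev_pos inK
    proof eventually_elim
      case (elim t)
      let ?x = "xi t"
      define y where "y = Ss - S t"
      have q0: "q ?x > 0" using elim ord by (intro q_pos) (auto simp: K_def)
      have Ct: "C t = Cs + y - A t" by (simp add: y_def C_eq_S Ss_def)
      have St: "S t - Ss = - y" by (simp add: y_def)
      have fq: "f ?x * q ?x = (H ?x - 2 * G ?x) * kap ?x"
        using q0 by (simp add: f_def H_def G_def)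
      have De: "D = (G ?x + Cs) * q ?x" using q0 by (simp add: G_def)
      have mue: "mu ?x = (H ?x + Cs) * kap ?x" using kap_pos[of ?x] by (simp add: H_def)
      have "?v' t = (f ?x * q ?x) * (G ?x - y) - y * (y - H ?x) * kap ?x + A t * E (xi t, S t)"
        unfolding E_def fst_conv snd_conv Ct St mue by (subst De) (simp add: algebra_simps)
      \<comment> \<open>The mixed terms in \<open>H * y\<close> cancel by the choice of the weight,
        and \<open>(y - G)^2\<close> is completed.\<close>
      also have "\<dots> = - W (xi t, S t) + A t * E (xi t, S t)"
        unfolding fq W_def fst_conv snd_conv y_def[symmetric] by (simp add: power2_eq_square algebra_simps)
      also have "\<dots> \<le> - W (xi t, S t) + A t * B"
        using B[OF elim(2)] nonneg[of t] elim by (intro add_left_mono mult_left_mono) auto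
      finally show ?case .
    qed
    show "((\<lambda>t. A t * B) \<longlongrightarrow> 0) at_top"
      using tendsto_mult_left_zero[OF A_tendsto] .
  qed
qed

text \<open>\<open>L\<close> and \<open>R\<close> are recovered as \<open>S\<close> times the
  averages with coefficients \<open>1, 0\<close> and \<open>0, 1\<close>, which are continuous in
  \<open>xi\<close>.\<close>

lemma tendsto_coords:
  assumes "D \<ge> 0"
  shows "(L \<longlongrightarrow> Ss * rs / (rs + 1)) at_top" "(R \<longlongrightarrow> Ss / (rs + 1)) at_top"
proof -
  have "(xi \<longlongrightarrow> xs) at_top \<and> (S \<longlongrightarrow> Ss) at_top"
  proof (cases "D = 0")
    case True
    then show ?thesis using xi_tendsto_balanced S_tendsto_balanced by blast
  next
    case False
    then show ?thesis
      using tendsto_fst[OF tendsto_unbalanced] tendsto_snd[OF tendsto_unbalanced] assms by simp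
  qed
  then have "((\<lambda>t. S t * avg a b (xi t)) \<longlongrightarrow> Ss * avg a b xs) at_top" for a b
    by (intro tendsto_mult isCont_tendsto_compose[of _ "avg a b"] continuous_on_interior[of UNIV]
        continuous_on_avg) auto
  then have "((\<lambda>t. a * L t + b * R t) \<longlongrightarrow> Ss * avg a b xs) at_top" for a b
    by (rule Lim_transform_eventually) (use ev_pos in \<open>eventually_elim, simp add: S_avg\<close>)
  from this[of 1 0] this[of 0 1]
  show "(L \<longlongrightarrow> Ss * rs / (rs + 1)) at_top" "(R \<longlongrightarrow> Ss / (rs + 1)) at_top"
    by (simp_all add: avg_def exp_xs)
qed

text \<open>If \<open>D < 0\<close>, the exchanged orbit has \<open>D > 0\<close>, and its limit
  with ratio \<open>1 / rs\<close> is the same point with the coordinates swapped.\<close>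

lemma tendsto_endemic:
  "(L \<longlongrightarrow> (1 - Cs) * rs / (rs + 1)) at_top" "(R \<longlongrightarrow> (1 - Cs) / (rs + 1)) at_top"
proof -
  interpret sw: endemic_orbit aR aL mR mL gLR gRL dR dL rho R L A C "1 / rs" Cs by (rule swap_endemic)
  have "(L \<longlongrightarrow> (1 - Cs) * rs / (rs + 1)) at_top \<and> (R \<longlongrightarrow> (1 - Cs) / (rs + 1)) at_top"
  proof (cases "D \<ge> 0")
    case True
    then show ?thesis using tendsto_coords by (simp add: Ss_def)
  next
    case False
    then have "sw.D \<ge> 0" by (simp add: sw.D_def D_def)
    have "1 / rs + 1 = (rs + 1) / rs" using rs by (simp add: field_simps)
    then have "(1 - Cs) * (1 / rs) / (1 / rs + 1) = (1 - Cs) / (rs + 1)"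
      "(1 - Cs) / (1 / rs + 1) = (1 - Cs) * rs / (rs + 1)" using rs by simp_all
    with sw.tendsto_coords[OF \<open>sw.D \<ge> 0\<close>] show ?thesis unfolding sw.Ss_def by metis
  qed
  then show "(L \<longlongrightarrow> (1 - Cs) * rs / (rs + 1)) at_top" "(R \<longlongrightarrow> (1 - Cs) / (rs + 1)) at_top"
    by blast+
qed

end

section \<open>The Perron root and the global dynamics\<close>

text \<open>The discriminant \<open>(p - s)^2 + 4 * g\<close> exceeds \<open>(p - s)^2\<close>, so
  there are two real roots and the larger one lies beyond both \<open>p\<close> and
  \<open>s\<close>.\<close>

lemma Max_quadratic_roots:
  fixes p s g :: real
  assumes "g > 0"
  defines "l \<equiv> Max {l. (l - p) * (l - s) = g}"
  shows "(l - p) * (l - s) = g" "p < l" "s < l"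
proof -
  define d where "d = sqrt ((p - s)\<^sup>2 + 4 * g)"
  have d2: "d\<^sup>2 = (p - s)\<^sup>2 + 4 * g" and d0: "d \<ge> 0" using assms by (auto simp: d_def)
  have "sqrt ((p - s)\<^sup>2) < d" unfolding d_def using assms by (intro real_sqrt_less_mono) simp
  then have d: "\<bar>p - s\<bar> < d" by simp
  have "(x - p) * (x - s) = g \<longleftrightarrow> x = (p + s + d) / 2 \<or> x = (p + s - d) / 2" for x
  proof -
    have "(x - p) * (x - s) = g \<longleftrightarrow> (x - (p + s + d) / 2) * (x - (p + s - d) / 2) = 0"
    proof -
      have "(2 * x - (p + s + d)) * (2 * x - (p + s - d)) = 4 * ((x - p) * (x - s) - g)"
        using d2 by algebra
      moreover have "(x - (p + s + d) / 2) * (x - (p + s - d) / 2)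
          = (2 * x - (p + s + d)) * (2 * x - (p + s - d)) / 4"
        by (simp add: field_simps)
      ultimately have "(x - (p + s + d) / 2) * (x - (p + s - d) / 2) = (x - p) * (x - s) - g" by simp
      then show ?thesis by (simp only: right_minus_eq)
    qed
    then show ?thesis by simp
  qed
  then have set_eq: "{x. (x - p) * (x - s) = g} = {(p + s + d) / 2, (p + s - d) / 2}"
    by (simp only: set_eq_iff mem_Collect_eq insert_iff empty_iff simp_thms)
  have l: "l = (p + s + d) / 2" unfolding l_def set_eq using d0 by simp
  have "l \<in> {x. (x - p) * (x - s) = g}" unfolding set_eq l by simp
  then show "(l - p) * (l - s) = g" by simp
  show "p < l" "s < l" unfolding l using d by auto
qed

text \<open>\<open>matrix_inv\<close> is a choice, which an exhibited two-sided inverse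
  determines.\<close>

lemma matrix_inv_eqI:
  fixes A B :: "'a::semiring_1^'n^'n"
  assumes "A ** B = mat 1" "B ** A = mat 1"
  shows "matrix_inv A = B"
proof -
  have "A ** matrix_inv A = mat 1 \<and> matrix_inv A ** A = mat 1"
    unfolding matrix_inv_def by (rule someI[of _ B]) (use assms in auto)
  then show ?thesis
    using assms by (metis matrix_mul_assoc matrix_mul_lid matrix_mul_rid)
qed

context radicalization
begin

text \<open>The characteristic equation of the matrix, multiplied by \<open>mL * mR\<close>. The two
  strict inequalities single out the Perron root and make the eigenvectors built from it
  positive.\<close>

lemma R_rad_root:
  defines "l \<equiv> R_rad aL aR mL mR gRL gLR"
  shows "(l * mL - aL) * (l * mR - aR) = gRL * gLR" "aL < l * mL" "aR < l * mR" "l > 0"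
proof -
  have "Mmat mL mR ** Mmat (1 / mL) (1 / mR) = mat 1" "Mmat (1 / mL) (1 / mR) ** Mmat mL mR = mat 1"
    using pos by (simp_all add: vec_eq_iff forall_2 matrix_matrix_mult_def sum_2 Mmat_def mat_def)
  then have inv: "matrix_inv (Mmat mL mR) = Mmat (1 / mL) (1 / mR)"
    by (rule matrix_inv_eqI)
  have "det (mat x - Mmat (1 / mL) (1 / mR) ** Kmat aL aR gRL gLR)
      = (x - aL / mL) * (x - aR / mR) - gRL * gLR / (mL * mR)" for x
    by (simp add: det_2 matrix_matrix_mult_def sum_2 Mmat_def Kmat_def mat_def)
  then have l: "l = Max {x. (x - aL / mL) * (x - aR / mR) = gRL * gLR / (mL * mR)}"
    unfolding l_def R_rad_def perron_root_def inv by simp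
  have g: "gRL * gLR / (mL * mR) > 0" using pos by simp
  note roots = Max_quadratic_roots[OF g, where p = "aL / mL" and s = "aR / mR", folded l]
  show "aL < l * mL" "aR < l * mR" using roots(2,3) pos by (simp_all add: field_simps)
  have "0 < aL / mL" using pos by simp
  with roots(2) show "l > 0" by linarith
  have "(l * mL - aL) * (l * mR - aR) = ((l - aL / mL) * (l - aR / mR)) * (mL * mR)"
    using pos by (simp add: field_simps)
  then show "(l * mL - aL) * (l * mR - aR) = gRL * gLR"
    unfolding roots(1) using pos by simp
qed

abbreviation "F \<equiv> field aL aR mL mR gRL gLR dL dR rho"

lemma orbit_of_trajectory:
  assumes "trajectory F x"
  shows "radicalization_orbit aL aR mL mR gRL gLR dL dR rho
    (\<lambda>t. fst (x t)) (\<lambda>t. fst (snd (x t))) (\<lambda>t. snd (snd (x t)))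
    (\<lambda>t. 1 - fst (x t) - fst (snd (x t)) - snd (snd (x t)))"
proof unfold_locales
  show "0 \<le> fst (x 0)" "0 \<le> fst (snd (x 0))" "0 \<le> snd (snd (x 0))"
    "0 \<le> 1 - fst (x 0) - fst (snd (x 0)) - snd (snd (x 0))"
    using assms by (auto simp: trajectory_def simplexT_def split: prod.splits)
  fix t :: real assume "t \<ge> 0"
  then have d: "(x has_vector_derivative F (x t)) (at t within {0..})"
    using assms by (simp add: trajectory_def)
  note d' = bounded_linear.has_vector_derivative[OF _ d]
  note ds = d'[OF bounded_linear_fst] d'[OF bounded_linear_fst_comp[OF bounded_linear_snd]]
    d'[OF bounded_linear_snd_comp[OF bounded_linear_snd]]
  note ds' = ds[folded has_real_derivative_iff_has_vector_derivative]
  show "((\<lambda>t. fst (x t)) has_real_derivative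
      aL * fst (x t) * (1 - fst (x t) - fst (snd (x t)) - snd (snd (x t)))
      + gRL * fst (snd (x t)) * (1 - fst (x t) - fst (snd (x t)) - snd (snd (x t)))
      + dL * snd (snd (x t)) * fst (x t) - mL * fst (x t)) (at t within {0..})"
    by (rule DERIV_cong[OF ds'(1)]) (simp add: field_def Let_def split: prod.splits)
  show "((\<lambda>t. fst (snd (x t))) has_real_derivative
      aR * fst (snd (x t)) * (1 - fst (x t) - fst (snd (x t)) - snd (snd (x t)))
      + gLR * fst (x t) * (1 - fst (x t) - fst (snd (x t)) - snd (snd (x t)))
      + dR * snd (snd (x t)) * fst (snd (x t)) - mR * fst (snd (x t))) (at t within {0..})"
    by (rule DERIV_cong[OF ds'(2)]) (simp add: field_def Let_def split: prod.splits)
  show "((\<lambda>t. snd (snd (x t))) has_real_derivative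
      - dL * snd (snd (x t)) * fst (x t) - dR * snd (snd (x t)) * fst (snd (x t)) - rho * snd (snd (x t)))
      (at t within {0..})"
    by (rule DERIV_cong[OF ds'(3)]) (simp add: field_def Let_def split: prod.splits)
qed auto

lemma GAS_origin:
  assumes "R_rad aL aR mL mR gRL gLR \<le> 1"
  shows "GAS_on_T F (0, 0, 0)"
proof -
  define l where "l = R_rad aL aR mL mR gRL gLR"
  \<comment> \<open>\<open>(gLR, w)\<close> is the positive left eigenvector of \<open>K\<close>
    relative to \<open>l * M\<close>; its second equation is the characteristic equation.\<close>
  define w where "w = l * mL - aL"
  note root = R_rad_root[folded l_def]
  have w: "gLR > 0" "w > 0" and l: "l > 0" "l \<le> 1"
    and eig: "gLR * aL + w * gLR = l * mL * gLR" "gLR * gRL + w * aR = l * mR * w"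
    using root pos assms by (auto simp: w_def l_def[symmetric] algebra_simps)
  define M where "M = (gLR + w) / min gLR w * exp ((dL + dR) / rho)"
  have M: "M > 0" using w by (simp add: M_def)
  show ?thesis
    unfolding GAS_on_T_def
  proof (intro conjI allI impI)
    show "equilibrium F (0, 0, 0)" by (simp add: equilibrium_def field_def zero_prod_def)
  next
    fix \<epsilon> :: real assume \<epsilon>: "\<epsilon> > 0"
    \<comment> \<open>Each of the three coordinates starts below \<open>d\<close>, and their sum can
      grow at most by the factor \<open>M + 1\<close>.\<close>
    define d' where "d' = \<epsilon> / (M + 1)"
    define d where "d = d' / 3"
    have "d' > 0" "(M + 1) * d' = \<epsilon>" using \<epsilon> M by (simp_all add: d'_def)
    then have d: "d > 0" "(M + 1) * (3 * d) = \<epsilon>" by (simp_all add: d_def)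
    show "\<exists>\<delta>>0. \<forall>x. trajectory F x \<and> dist (x 0) (0, 0, 0) < \<delta> \<longrightarrow> (\<forall>t\<ge>0. dist (x t) (0, 0, 0) < \<epsilon>)"
    proof (intro exI[of _ d] conjI allI impI d(1))
      fix x and t :: real assume x: "trajectory F x \<and> dist (x 0) (0, 0, 0) < d" and t: "t \<ge> 0"
      obtain X Y Z where X: "x = (\<lambda>t. (X t, Y t, Z t))"
      by (rule that[of "\<lambda>t. fst (x t)" "\<lambda>t. fst (snd (x t))" "\<lambda>t. snd (snd (x t))"]) simp
      interpret radicalization_orbit aL aR mL mR gRL gLR dL dR rho X Y Z "\<lambda>t. 1 - X t - Y t - Z t"
        using orbit_of_trajectory[of x] x by (simp add: X)
      have "norm (X 0, Y 0, Z 0) < d"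
        using x by (simp add: X zero_prod_def[symmetric])
      moreover have "norm (X 0) \<le> norm (X 0, Y 0, Z 0)" "norm (Y 0) \<le> norm (X 0, Y 0, Z 0)"
        "norm (Z 0) \<le> norm (X 0, Y 0, Z 0)"
        using norm_fst_le[of "X 0" "(Y 0, Z 0)"] norm_snd_le[of "(Y 0, Z 0)" "X 0"]
          norm_fst_le[of "Y 0" "Z 0"] norm_snd_le[of "Z 0" "Y 0"] by linarith+
      ultimately have d0: "X 0 < d" "Y 0 < d" "Z 0 < d" by auto
      have "dist (x t) (0, 0, 0) = norm (X t, Y t, Z t)"
        by (simp add: X zero_prod_def[symmetric])
      also have "\<dots> \<le> X t + Y t + Z t"
        using norm_Pair_le[of "X t" "(Y t, Z t)"] norm_Pair_le[of "Y t" "Z t"] nonneg[OF t] by simp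
      also have "\<dots> \<le> M * (X 0 + Y 0) + Z 0"
        using radicals_bound[OF w l eig t] A_le(2)[OF t] unfolding M_def by linarith
      also have "\<dots> \<le> (M + 1) * (X 0 + Y 0 + Z 0)"
        using init M by (simp add: algebra_simps)
      also have "\<dots> < (M + 1) * (3 * d)"
        using d0 M by (intro mult_strict_left_mono) auto
      finally show "dist (x t) (0, 0, 0) < \<epsilon>" unfolding d(2) .
    qed
  next
    fix x assume x: "trajectory F x"
    obtain X Y Z where X: "x = (\<lambda>t. (X t, Y t, Z t))"
      by (rule that[of "\<lambda>t. fst (x t)" "\<lambda>t. fst (snd (x t))" "\<lambda>t. snd (snd (x t))"]) simp
    interpret radicalization_orbit aL aR mL mR gRL gLR dL dR rho X Y Z "\<lambda>t. 1 - X t - Y t - Z t"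
      using orbit_of_trajectory[OF x] by (simp add: X)
    show "(x \<longlongrightarrow> (0, 0, 0)) at_top"
      unfolding X by (intro tendsto_Pair radicals_tendsto_0[OF w l eig] A_tendsto)
  qed
qed

lemma axis_invariant:
  assumes "trajectory F x" "x 0 \<in> axisGamma"
  shows "t \<ge> 0 \<Longrightarrow> x t \<in> axisGamma" "(x \<longlongrightarrow> (0, 0, 0)) at_top"
proof -
  obtain X Y Z where X: "x = (\<lambda>t. (X t, Y t, Z t))"
      by (rule that[of "\<lambda>t. fst (x t)" "\<lambda>t. fst (snd (x t))" "\<lambda>t. snd (snd (x t))"]) simp
  interpret radicalization_orbit aL aR mL mR gRL gLR dL dR rho X Y Z "\<lambda>t. 1 - X t - Y t - Z t"
    using orbit_of_trajectory[OF assms(1)] by (simp add: X)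
  have zero: "X t = 0" "Y t = 0" if "t \<ge> 0" for t
    using radicals_zero[of t] that assms(2) by (auto simp: X axisGamma_def)
  show "x t \<in> axisGamma" if "t \<ge> 0"
    using zero[OF that] nonneg[OF that] by (auto simp: X axisGamma_def simplexT_def)
  have "(X \<longlongrightarrow> 0) at_top" "(Y \<longlongrightarrow> 0) at_top"
    by (rule tendsto_eventually, rule eventually_mono[OF eventually_ge_at_top[of 0]], erule zero)+
  then show "(x \<longlongrightarrow> (0, 0, 0)) at_top"
    unfolding X by (intro tendsto_Pair A_tendsto)
qed

text \<open>At an equilibrium with both radical shares positive, \<open>A\<close> vanishes and
  \<open>(L, R)\<close> is a positive right eigenvector of \<open>K\<close> relative to
  \<open>M / C\<close>. This forces \<open>1 / C\<close> to be the Perron root and fixes the ratio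
  \<open>L / R\<close>.\<close>

lemma endemic_equilibrium:
  assumes gt: "R_rad aL aR mL mR gRL gLR > 1"
  obtains Ls Rs where "Ls > 0" "Rs > 0" "(Ls, Rs, 0) \<in> simplexT" "equilibrium F (Ls, Rs, 0)"
    "\<And>L R A. equilibrium F (L, R, A) \<Longrightarrow> L > 0 \<Longrightarrow> R > 0 \<Longrightarrow> (L, R, A) = (Ls, Rs, 0)"
    "\<And>x. trajectory F x \<Longrightarrow> x 0 \<notin> axisGamma \<Longrightarrow> (x \<longlongrightarrow> (Ls, Rs, 0)) at_top"
proof -
  define l where "l = R_rad aL aR mL mR gRL gLR"
  note root = R_rad_root[folded l_def]
  have l: "l > 1" using gt by (simp add: l_def)
  define Cs where "Cs = 1 / l"
  \<comment> \<open>\<open>(rs, 1)\<close> is the right eigenvector of \<open>K\<close> relative to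
    \<open>l * M\<close>; the total \<open>1 - Cs\<close> is then split in the ratio
    \<open>rs\<close> to 1.\<close>
  define rs where "rs = gRL / (l * mL - aL)"
  have Cs: "0 < Cs" "Cs < 1" using l by (auto simp: Cs_def)
  have rs: "rs > 0" using root pos by (simp add: rs_def)
  have "gLR * rs = l * mR - aR"
    using root by (simp add: rs_def field_simps)
  then have eqR: "Cs * (aR + gLR * rs) = mR" using l by (simp add: Cs_def)
  have rs_eq: "(l * mL - aL) * rs = gRL" using root by (simp add: rs_def)
  then have "aL * rs + gRL = l * (mL * rs)" by (simp add: algebra_simps)
  then have eqL: "Cs * (aL * rs + gRL) = mL * rs" using l by (simp add: Cs_def)
  define Ls where "Ls = (1 - Cs) * rs / (rs + 1)"
  define Rs where "Rs = (1 - Cs) / (rs + 1)"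
  have Ls_eq: "Ls = rs * Rs" by (simp add: Ls_def Rs_def)
  have pos': "Ls > 0" "Rs > 0" using Cs rs by (simp_all add: Ls_def Rs_def)
  have sum: "Ls + Rs = 1 - Cs"
  proof -
    have "Rs * (rs + 1) = 1 - Cs" using rs by (simp add: Rs_def)
    then show ?thesis by (simp add: Ls_eq algebra_simps)
  qed
  show thesis
  proof
    show "Ls > 0" "Rs > 0" by (rule pos')+
    show "(Ls, Rs, 0) \<in> simplexT" using pos' sum Cs by (simp add: simplexT_def)
    have "Rs * (Cs * (aL * rs + gRL)) = Rs * (mL * rs)" "Rs * (Cs * (aR + gLR * rs)) = Rs * mR"
      unfolding eqL eqR by simp_all
    then have "aL * Ls * Cs + gRL * Rs * Cs - mL * Ls = 0" "aR * Rs * Cs + gLR * Ls * Cs - mR * Rs = 0"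
      by (simp_all add: Ls_eq algebra_simps)
    moreover have "1 - Ls - Rs = Cs" using sum by simp
    ultimately show "equilibrium F (Ls, Rs, 0)"
      by (simp add: equilibrium_def field_def Let_def zero_prod_def)
  next
    fix L R A assume e: "equilibrium F (L, R, A)" and LR: "L > 0" "R > 0"
    define C where "C = 1 - L - R - A"
    have e1: "aL * L * C + gRL * R * C + dL * A * L - mL * L = 0"
      and e2: "aR * R * C + gLR * L * C + dR * A * R - mR * R = 0"
      and e3: "- dL * A * L - dR * A * R - rho * A = 0"
      using e by (simp_all add: equilibrium_def field_def Let_def zero_prod_def C_def)
    from e3 have "A * (dL * L + dR * R + rho) = 0" by (simp add: algebra_simps)
    moreover have "dL * L + dR * R + rho > 0" using LR pos by (simp add: add_pos_pos)
    ultimately have A: "A = 0" by simp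
    from e1 have f1: "C * (aL * L + gRL * R) = mL * L" using A by (simp add: algebra_simps)
    from e2 have f2: "C * (aR * R + gLR * L) = mR * R" using A by (simp add: algebra_simps)
    have "C * (aL * L + gRL * R) > 0" unfolding f1 using pos LR by simp
    moreover have "aL * L + gRL * R > 0" using pos LR by (simp add: add_pos_pos)
    ultimately have C: "C > 0" by (simp add: zero_less_mult_iff)
    \<comment> \<open>\<open>u\<close> satisfies the same characteristic equation as
      \<open>l\<close>, and positivity of \<open>L\<close> and \<open>R\<close> places it beyond
      \<open>aL / mL\<close> and \<open>aR / mR\<close>.\<close>
    define u where "u = 1 / C"
    have uC: "u * C = 1" using C by (simp add: u_def)
    have u1: "(u * mL - aL) * L = gRL * R"
    proof -
      have "(u * C) * (aL * L + gRL * R) = u * (mL * L)" by (simp only: f1 mult.assoc)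
      then show ?thesis unfolding uC by (simp add: algebra_simps)
    qed
    have u2: "(u * mR - aR) * R = gLR * L"
    proof -
      have "(u * C) * (aR * R + gLR * L) = u * (mR * R)" by (simp only: f2 mult.assoc)
      then show ?thesis unfolding uC by (simp add: algebra_simps)
    qed
    have "(u * mL - aL) * L > 0" "(u * mR - aR) * R > 0" unfolding u1 u2 using pos LR by simp_all
    then have up: "u * mL - aL > 0" "u * mR - aR > 0" using LR by (simp_all add: zero_less_mult_iff)
    have "((u * mL - aL) * (u * mR - aR)) * (L * R) = ((u * mL - aL) * L) * ((u * mR - aR) * R)"
      by (simp add: algebra_simps)
    also have "\<dots> = (gRL * gLR) * (L * R)" unfolding u1 u2 by (simp add: algebra_simps)
    finally have u3: "(u * mL - aL) * (u * mR - aR) = gRL * gLR" using LR by simp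
    \<comment> \<open>In that range both linear factors are positive and increasing, so their
      product takes the value \<open>gRL * gLR\<close> only once.\<close>
    have "u = l"
    proof (rule ccontr)
      assume "u \<noteq> l"
      then consider "u < l" | "l < u" by linarith
      then show False
      proof cases
        case 1
        then have "(u * mL - aL) * (u * mR - aR) < (l * mL - aL) * (l * mR - aR)"
          using root up pos by (intro mult_strict_mono) auto
        then show False using u3 root(1) by simp
      next
        case 2
        then have "(l * mL - aL) * (l * mR - aR) < (u * mL - aL) * (u * mR - aR)"
          using root up pos by (intro mult_strict_mono) auto
        then show False using u3 root(1) by simp
      qed
    qed
    then have "C = Cs" using uC l by (simp add: Cs_def field_simps)
    have "(l * mL - aL) * L = (l * mL - aL) * (rs * R)"
      using u1 \<open>u = l\<close> rs_eq by (simp add: mult.assoc[symmetric])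
    then have L: "L = rs * R" using root by simp
    with \<open>C = Cs\<close> A have "R * (rs + 1) = 1 - Cs" by (simp add: C_def algebra_simps)
    then have "R = Rs" using rs by (simp add: Rs_def field_simps)
    then show "(L, R, A) = (Ls, Rs, 0)" using L A Ls_eq by simp
  next
    fix x assume x: "trajectory F x" "x 0 \<notin> axisGamma"
    obtain X Y Z where X: "x = (\<lambda>t. (X t, Y t, Z t))"
      by (rule that[of "\<lambda>t. fst (x t)" "\<lambda>t. fst (snd (x t))" "\<lambda>t. snd (snd (x t))"]) simp
    interpret radicalization_orbit aL aR mL mR gRL gLR dL dR rho X Y Z "\<lambda>t. 1 - X t - Y t - Z t"
      using orbit_of_trajectory[OF x(1)] by (simp add: X)
    have "X 0 \<noteq> 0 \<or> Y 0 \<noteq> 0"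
      using x by (auto simp: X trajectory_def axisGamma_def)
    note nz = pos_if_radicals_nonzero[OF this]
    interpret endemic_orbit aL aR mL mR gRL gLR dL dR rho X Y Z "\<lambda>t. 1 - X t - Y t - Z t" rs Cs
      by unfold_locales (use rs Cs eqL eqR nz in auto)
    show "(x \<longlongrightarrow> (Ls, Rs, 0)) at_top"
      unfolding X Ls_def Rs_def by (intro tendsto_Pair tendsto_endemic A_tendsto)
  qed
qed

end

theorem theorem6p8:
  fixes aL aR mL mR gRL gLR dL dR rho :: real
  assumes pos: "aL > 0" "aR > 0" "mL > 0" "mR > 0" "gRL > 0" "gLR > 0"
    "dL > 0" "dR > 0" "rho > 0"
  defines "F \<equiv> field aL aR mL mR gRL gLR dL dR rho"
  shows "(R_rad aL aR mL mR gRL gLR \<le> 1 \<longrightarrow> GAS_on_T F (0, 0, 0))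
    \<and> (R_rad aL aR mL mR gRL gLR > 1 \<longrightarrow>
        (\<exists>Ls Rs. Ls > 0 \<and> Rs > 0 \<and> (Ls, Rs, 0) \<in> simplexT \<and> equilibrium F (Ls, Rs, 0) \<and>
           (\<forall>L R A. equilibrium F (L, R, A) \<and> L > 0 \<and> R > 0 \<longrightarrow> (L, R, A) = (Ls, Rs, 0)) \<and>
           (\<forall>x. trajectory F x \<and> x 0 \<in> axisGamma \<longrightarrow>
               (\<forall>t\<ge>0. x t \<in> axisGamma) \<and> (x \<longlongrightarrow> (0, 0, 0)) at_top) \<and>
           (\<forall>x. trajectory F x \<and> x 0 \<notin> axisGamma \<longrightarrow> (x \<longlongrightarrow> (Ls, Rs, 0)) at_top)))"
proof -
  interpret radicalization aL aR mL mR gRL gLR dL dR rho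
    by unfold_locales (use pos in auto)
  show ?thesis
  proof (intro conjI impI)
    assume "R_rad aL aR mL mR gRL gLR \<le> 1"
    then show "GAS_on_T F (0, 0, 0)" unfolding F_def by (rule GAS_origin)
  next
    assume "R_rad aL aR mL mR gRL gLR > 1"
    from endemic_equilibrium[OF this, folded F_def] obtain Ls Rs where E:
      "Ls > 0" "Rs > 0" "(Ls, Rs, 0) \<in> simplexT" "equilibrium F (Ls, Rs, 0)"
      "\<And>L R A. equilibrium F (L, R, A) \<Longrightarrow> L > 0 \<Longrightarrow> R > 0 \<Longrightarrow> (L, R, A) = (Ls, Rs, 0)"
      "\<And>x. trajectory F x \<Longrightarrow> x 0 \<notin> axisGamma \<Longrightarrow> (x \<longlongrightarrow> (Ls, Rs, 0)) at_top"
      by blast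
    show "\<exists>Ls Rs. Ls > 0 \<and> Rs > 0 \<and> (Ls, Rs, 0) \<in> simplexT \<and> equilibrium F (Ls, Rs, 0) \<and>
           (\<forall>L R A. equilibrium F (L, R, A) \<and> L > 0 \<and> R > 0 \<longrightarrow> (L, R, A) = (Ls, Rs, 0)) \<and>
           (\<forall>x. trajectory F x \<and> x 0 \<in> axisGamma \<longrightarrow>
               (\<forall>t\<ge>0. x t \<in> axisGamma) \<and> (x \<longlongrightarrow> (0, 0, 0)) at_top) \<and>
           (\<forall>x. trajectory F x \<and> x 0 \<notin> axisGamma \<longrightarrow> (x \<longlongrightarrow> (Ls, Rs, 0)) at_top)"
      by (intro exI[of _ Ls] exI[of _ Rs] conjI allI impI)
        (use E axis_invariant[folded F_def] in blast)+
  qed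
qed

end
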